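(* Let $M_1,M_2$ be matroids of positive rank on disjoint ground sets $S_1,S_2$, with $S'_1\subseteq S_1$, $S'_2\subseteq S_2$, and let $k$ be an integer with $k\ge r(M_1)+\eta_{M_1}(S'_1)+r(M_2)+\eta_{M_2}(S'_2)$. Let $T_1,T_2$ be sets with $|T_1|=k-r(M_1)-|S'_2|$, $|T_2|=k-r(M_2)-|S'_1|$ such that $T_1,T_2,S_1\cup S_2$ are pairwise disjoint, and let $M=M_k(M_1,S'_1,T_1;M_2,S'_2,T_2)$. Then $M_1$ and $M_2$ are both transversal if and only if $M$ is transversal. The same equivalence holds with "transversal" replaced by "cotransversal", by "bitransversal", and by "a gammoid".
   Context: All matroids are finite. A matroid is cotransversal if its dual is transversal, bitransversal if it is both transversal and cotransversal, and a gammoid if it is a minor of a transversal matroid. A cyclic flat is a flat that is a (possibly empty) union of circuits; for a matroid $N$, $\mathcal{Z}'(N)$ denotes its set of nonempty proper cyclic flats, and $\eta_N(Y)=|Y|-r_N(Y)$ is the nullity. Construction $M_k(N_1,A_1,U_1;N_2,A_2,U_2)$: let $N_1,N_2$ be matroids of positive rank on disjoint ground sets $R_1,R_2$ with rank functions $\rho_1,\rho_2$; let $A_1\subseteq R_1$, $A_2\subseteq R_2$; let $k$ be an integer with $k\ge r(N_1)+\eta_{N_1}(A_1)+r(N_2)+\eta_{N_2}(A_2)$; and let $U_1,U_2$ be sets with $|U_1|=k-r(N_1)-|A_2|$, $|U_2|=k-r(N_2)-|A_1|$, such that $U_1,U_2,R_1\cup R_2$ are pairwise disjoint. Let $E=R_1\cup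 R_2\cup U_1\cup U_2$. Then $M_k(N_1,A_1,U_1;N_2,A_2,U_2)$ is the (existing and unique) matroid on $E$ whose cyclic flats are exactly: $\emptyset$, of rank $0$; $E$, of rank $k$; the sets $F\cup U_1\cup A_2$ for $F\in\mathcal{Z}'(N_1)$, of rank $\rho_1(F)+|U_1|+|A_2|$; and the sets $F\cup U_2\cup A_1$ for $F\in\mathcal{Z}'(N_2)$, of rank $\rho_2(F)+|U_2|+|A_1|$. *)

theory Defs
  imports Main
begin

section \<open>Finite matroids\<close>

definition is_matroid :: "'a set \<Rightarrow> 'a set set \<Rightarrow> bool" where
  "is_matroid E I \<longleftrightarrow>
     finite E \<and> {} \<in> I \<and> (\<forall>X\<in>I. X \<subseteq> E) \<and>
     (\<forall>X\<in>I. \<forall>Y. Y \<subseteq> X \<longrightarrow> Y \<in> I) \<and>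
     (\<forall>X\<in>I. \<forall>Y\<in>I. card X < card Y \<longrightarrow> (\<exists>y\<in>Y - X. insert y X \<in> I))"

typedef 'a matroid = "{p :: 'a set \<times> 'a set set. is_matroid (fst p) (snd p)}"
  by (rule exI [of _ "({}, {{}})"]) (auto simp: is_matroid_def)

setup_lifting type_definition_matroid

lift_definition ground :: "'a matroid \<Rightarrow> 'a set" is fst .

lift_definition indep :: "'a matroid \<Rightarrow> 'a set \<Rightarrow> bool" is "\<lambda>(E, I) X. X \<in> I" .

definition rk :: "'a matroid \<Rightarrow> 'a set \<Rightarrow> nat" where
  "rk M X = Max (card ` {I. I \<subseteq> X \<and> indep M I})"

definition matroid_rank :: "'a matroid \<Rightarrow> nat" where
  "matroid_rank M = rk M (ground M)"

definition nullity :: "'a matroid \<Rightarrow> 'a set \<Rightarrow> nat" where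
  "nullity M X = card X - rk M X"

definition circuit :: "'a matroid \<Rightarrow> 'a set \<Rightarrow> bool" where
  "circuit M C \<longleftrightarrow> C \<subseteq> ground M \<and> \<not> indep M C \<and> (\<forall>D. D \<subset> C \<longrightarrow> indep M D)"

definition flat :: "'a matroid \<Rightarrow> 'a set \<Rightarrow> bool" where
  "flat M F \<longleftrightarrow> F \<subseteq> ground M \<and> (\<forall>e\<in>ground M - F. rk M F < rk M (insert e F))"

definition cyclic_flat :: "'a matroid \<Rightarrow> 'a set \<Rightarrow> bool" where
  "cyclic_flat M F \<longleftrightarrow> flat M F \<and> (\<exists>\<C>. (\<forall>C\<in>\<C>. circuit M C) \<and> F = \<Union>\<C>)"

definition proper_cyclic_flats :: "'a matroid \<Rightarrow> 'a set set" where
  "proper_cyclic_flats M = {F. cyclic_flat M F \<and> F \<noteq> {} \<and> F \<noteq> ground M}"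

definition basis :: "'a matroid \<Rightarrow> 'a set \<Rightarrow> bool" where
  "basis M B \<longleftrightarrow> indep M B \<and> (\<forall>X. indep M X \<and> B \<subseteq> X \<longrightarrow> X = B)"


section \<open>Duality and minors\<close>

lemma is_matroidD:
  assumes "is_matroid E I"
  shows "finite E" "{} \<in> I" "X \<in> I \<Longrightarrow> X \<subseteq> E"
    "X \<in> I \<Longrightarrow> Y \<subseteq> X \<Longrightarrow> Y \<in> I"
    "X \<in> I \<Longrightarrow> Y \<in> I \<Longrightarrow> card X < card Y \<Longrightarrow> \<exists>y\<in>Y - X. insert y X \<in> I"
  using assms unfolding is_matroid_def by simp_all

lemma is_matroid_restrict:
  assumes "is_matroid E I"
  shows "is_matroid (E - X) {Y \<in> I. Y \<subseteq> E - X}"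
  unfolding is_matroid_def
proof (intro conjI ballI allI impI)
  show "finite (E - X)" "{} \<in> {Y \<in> I. Y \<subseteq> E - X}"
    using is_matroidD(1,2) [OF assms] by auto
next
  fix Y assume "Y \<in> {Y \<in> I. Y \<subseteq> E - X}" then show "Y \<subseteq> E - X" by simp
next
  fix Y Z assume "Y \<in> {Y \<in> I. Y \<subseteq> E - X}" "Z \<subseteq> Y"
  then show "Z \<in> {Y \<in> I. Y \<subseteq> E - X}"
    using is_matroidD(4) [OF assms, of Y Z] by auto
next
  fix Y Z assume *: "Y \<in> {Y \<in> I. Y \<subseteq> E - X}" "Z \<in> {Y \<in> I. Y \<subseteq> E - X}" "card Y < card Z"
  then obtain z where "z \<in> Z - Y" "insert z Y \<in> I"
    using is_matroidD(5) [OF assms, of Y Z] by auto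
  with * show "\<exists>z\<in>Z - Y. insert z Y \<in> {Y \<in> I. Y \<subseteq> E - X}"
    by (intro bexI [of _ z]) auto
qed

lemma is_matroid_extend:
  assumes m: "is_matroid E I" and "X \<in> I" "X \<subseteq> S" "Y \<in> I" "Y \<subseteq> S"
  shows "\<exists>Z\<in>I. X \<subseteq> Z \<and> Z \<subseteq> S \<and> card Y \<le> card Z"
  using assms(2,3)
proof (induction "card Y - card X" arbitrary: X rule: less_induct)
  case less
  show ?case
  proof (cases "card Y \<le> card X")
    case True
    with less.prems show ?thesis by blast
  next
    case False
    then obtain y where y: "y \<in> Y - X" "insert y X \<in> I"
      using is_matroidD(5) [OF m less.prems(1) assms(4)] by auto
    have "finite X"
      using finite_subset [OF is_matroidD(3,1) [OF m]] less.prems(1) by simp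
    with y have "card (insert y X) = Suc (card X)" by simp
    with False have "card Y - card (insert y X) < card Y - card X" by linarith
    moreover have "insert y X \<subseteq> S" using y assms(5) less.prems by blast
    ultimately obtain Z where "Z \<in> I" "insert y X \<subseteq> Z" "Z \<subseteq> S" "card Y \<le> card Z"
      using less.hyps [OF _ y(2)] by auto
    then show ?thesis by (intro bexI [of _ Z]) auto
  qed
qed

definition dual_indeps :: "'a set \<Rightarrow> 'a set set \<Rightarrow> 'a set set" where
  "dual_indeps E I =
     {X. X \<subseteq> E \<and> (\<exists>B\<in>I. (\<forall>Y\<in>I. B \<subseteq> Y \<longrightarrow> Y = B) \<and> B \<inter> X = {})}"

lemma is_matroid_dual:
  assumes m: "is_matroid E I"
  shows "is_matroid E (dual_indeps E I)"
proof -
  note fin = is_matroidD(1) [OF m] and emp = is_matroidD(2) [OF m]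
    and sub = is_matroidD(3) [OF m] and her = is_matroidD(4) [OF m]
  have finI: "finite X" if "X \<in> I" for X
    using finite_subset [OF sub [OF that] fin] .
  define Bs where "Bs = {B \<in> I. \<forall>Y\<in>I. B \<subseteq> Y \<longrightarrow> Y = B}"
  have Bs_max: "card Y \<le> card B" if "B \<in> Bs" "Y \<in> I" for B Y
  proof -
    have "B \<in> I" "B \<subseteq> E" "Y \<subseteq> E" using that sub by (auto simp: Bs_def)
    then obtain Z where "Z \<in> I" "B \<subseteq> Z" "card Y \<le> card Z"
      using is_matroid_extend [OF m, of B E Y] \<open>Y \<in> I\<close> by blast
    with that show ?thesis by (auto simp: Bs_def)
  qed
  have Bs_I: "B \<in> Bs" if "B \<in> I" "B' \<in> Bs" "card B' \<le> card B" for B B'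
  proof -
    have "Y = B" if Y: "Y \<in> I" "B \<subseteq> Y" for Y
    proof -
      have "card Y \<le> card B" using Bs_max [OF \<open>B' \<in> Bs\<close> Y(1)] \<open>card B' \<le> card B\<close> by simp
      then show ?thesis using card_seteq [OF finI [OF Y(1)] Y(2)] by simp
    qed
    with that show ?thesis by (auto simp: Bs_def)
  qed
  have D: "dual_indeps E I = {X. X \<subseteq> E \<and> (\<exists>B\<in>Bs. B \<inter> X = {})}"
    by (auto simp: dual_indeps_def Bs_def)
  have "I \<subseteq> Pow E" using sub by blast
  then have "finite I" using fin by (simp add: finite_subset)
  then have "\<exists>B\<in>I. \<forall>Y\<in>I. B \<subseteq> Y \<longrightarrow> B = Y"
    using finite_has_maximal [of I] emp by blast
  then have ne: "\<exists>B. B \<in> Bs" by (auto simp: Bs_def)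
  have aug: "\<exists>y\<in>Y - X. insert y X \<in> dual_indeps E I"
    if X: "X \<subseteq> E" "B1 \<in> Bs" "B1 \<inter> X = {}" and Y: "Y \<subseteq> E" "B2 \<in> Bs" "B2 \<inter> Y = {}"
      and less: "card X < card Y" for X Y B1 B2
  proof (rule ccontr)
    assume neg: "\<not> ?thesis"
    have "B1 \<in> I" "B2 \<in> I" using X Y by (auto simp: Bs_def)
    then have "B2 - X \<in> I" "B2 - X \<subseteq> E - X" "B1 \<subseteq> E - X"
      using her [of B2 "B2 - X"] sub [of B2] sub [of B1] X by auto
    then obtain B where B: "B \<in> I" "B2 - X \<subseteq> B" "B \<subseteq> E - X" "card B1 \<le> card B"
      using is_matroid_extend [OF m, of "B2 - X" "E - X" B1] \<open>B1 \<in> I\<close> by blast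
    then have "B \<in> Bs" using Bs_I [OF B(1) X(2) B(4)] by simp
    have YX: "Y - X \<subseteq> B"
    proof (rule ccontr)
      assume "\<not> ?thesis"
      then obtain y where "y \<in> Y - X" "y \<notin> B" by blast
      then have "insert y X \<subseteq> E" "B \<inter> insert y X = {}" using B(3) X(1) Y(1) by auto
      with \<open>B \<in> Bs\<close> have "insert y X \<in> dual_indeps E I" unfolding D by blast
      with neg \<open>y \<in> Y - X\<close> show False by blast
    qed
    have f: "finite X" "finite Y" "finite B" "finite B2"
      using finite_subset [OF X(1) fin] finite_subset [OF Y(1) fin]
        finI [OF B(1)] finI [OF \<open>B2 \<in> I\<close>] .
    have "card (Y - X) + card (B2 - X) = card ((Y - X) \<union> (B2 - X))"
      using f Y by (subst card_Un_disjoint) auto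
    also have "\<dots> \<le> card B" using YX B f by (intro card_mono) auto
    finally have 1: "card (Y - X) + card (B2 - X) \<le> card B" .
    have 2: "card B \<le> card B2" using Bs_max [OF Y(2) B(1)] .
    have "card B2 = card (B2 \<inter> X) + card (B2 - X)"
      using card_Un_disjoint [of "B2 \<inter> X" "B2 - X"] f(4) by (simp add: Int_Diff_Un Int_Diff_disjoint)
    moreover have "card (B2 \<inter> X) \<le> card (X - Y)"
      using f Y by (intro card_mono) auto
    moreover have "card (X - Y) < card (Y - X)"
      using f less by (metis card_less_sym_Diff)
    ultimately show False using 1 2 by linarith
  qed
  show ?thesis
    unfolding is_matroid_def
  proof (intro conjI ballI allI impI)
    show "finite E" by (rule fin)
    show "{} \<in> dual_indeps E I" using ne by (auto simp: D)
  next
    fix X assume "X \<in> dual_indeps E I" then show "X \<subseteq> E" by (simp add: D)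
  next
    fix X Y assume "X \<in> dual_indeps E I" "Y \<subseteq> X"
    then show "Y \<in> dual_indeps E I" unfolding D by blast
  next
    fix X Y assume X: "X \<in> dual_indeps E I" and Y: "Y \<in> dual_indeps E I"
      and less: "card X < card Y"
    obtain B1 where B1: "X \<subseteq> E" "B1 \<in> Bs" "B1 \<inter> X = {}"
      using X unfolding D by auto
    obtain B2 where B2: "Y \<subseteq> E" "B2 \<in> Bs" "B2 \<inter> Y = {}"
      using Y unfolding D by auto
    show "\<exists>y\<in>Y - X. insert y X \<in> dual_indeps E I"
      using aug [OF B1 B2 less] .
  qed
qed

lift_definition dual :: "'a matroid \<Rightarrow> 'a matroid" is "\<lambda>(E, I). (E, dual_indeps E I)"
  by (auto intro: is_matroid_dual)

lift_definition delete :: "'a matroid \<Rightarrow> 'a set \<Rightarrow> 'a matroid"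
  is "\<lambda>(E, I) X. (E - X, {Y \<in> I. Y \<subseteq> E - X})"
  by (auto intro: is_matroid_restrict)

lemma ground_dual [simp]: "ground (dual M) = ground M"
  by transfer auto

lemma indep_dual: "indep (dual M) X \<longleftrightarrow> X \<subseteq> ground M \<and> (\<exists>B. basis M B \<and> B \<inter> X = {})"
  unfolding basis_def by transfer (auto simp: dual_indeps_def)

lemma ground_delete [simp]: "ground (delete M X) = ground M - X"
  by transfer auto

lemma indep_delete: "indep (delete M X) Y \<longleftrightarrow> indep M Y \<and> Y \<subseteq> ground M - X"
  by transfer auto

definition contract :: "'a matroid \<Rightarrow> 'a set \<Rightarrow> 'a matroid" where
  "contract M X = dual (delete (dual M) X)"

definition minor_of :: "'a matroid \<Rightarrow> 'a matroid \<Rightarrow> bool" where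
  "minor_of N M \<longleftrightarrow>
     (\<exists>X Y. X \<subseteq> ground M \<and> Y \<subseteq> ground M \<and> X \<inter> Y = {} \<and> N = delete (contract M X) Y)"

definition isomorphic :: "'a matroid \<Rightarrow> 'b matroid \<Rightarrow> bool" where
  "isomorphic M N \<longleftrightarrow>
     (\<exists>f. bij_betw f (ground M) (ground N) \<and>
          (\<forall>X. X \<subseteq> ground M \<longrightarrow> (indep M X \<longleftrightarrow> indep N (f ` X))))"


section \<open>Transversal matroids and gammoids\<close>

definition partial_transversal :: "nat \<Rightarrow> (nat \<Rightarrow> 'a set) \<Rightarrow> 'a set \<Rightarrow> bool" where
  "partial_transversal n A X \<longleftrightarrow>
     (\<exists>f. inj_on f X \<and> (\<forall>x\<in>X. f x < n \<and> x \<in> A (f x)))"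

definition transversal :: "'a matroid \<Rightarrow> bool" where
  "transversal M \<longleftrightarrow>
     (\<exists>n A. (\<forall>j<n. A j \<subseteq> ground M) \<and>
            (\<forall>X. indep M X \<longleftrightarrow> partial_transversal n A X))"

definition cotransversal :: "'a matroid \<Rightarrow> bool" where
  "cotransversal M \<longleftrightarrow> transversal (dual M)"

definition bitransversal :: "'a matroid \<Rightarrow> bool" where
  "bitransversal M \<longleftrightarrow> transversal M \<and> cotransversal M"

text \<open>
  The ground set of the transversal matroid may have to be larger than the type
  \<^typ>\<open>'a\<close> allows. As matroids are finite, relabelling puts the transversal matroid
  on a set of natural numbers, whence the isomorphism.
\<close>
definition gammoid :: "'a matroid \<Rightarrow> bool" where
  "gammoid M \<longleftrightarrow>
     (\<exists>T N :: nat matroid. transversal T \<and> minor_of N T \<and> isomorphic M N)"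


section \<open>The construction\<close>

text \<open>
  \<open>is_Mk k N1 A1 U1 N2 A2 U2 M\<close> says that \<open>M\<close> is the matroid
  $M_k(N_1,A_1,U_1;N_2,A_2,U_2)$. A matroid is determined by its ground set and its cyclic
  flats with their ranks, so at most one \<open>M\<close> satisfies it. A predicate is used instead of a
  definite description because the whole ground set can fail to be cyclic when coloops
  are present: if \<open>N1\<close> and \<open>N2\<close> are free, \<open>A1\<close> and \<open>A2\<close> are their ground sets and \<open>k\<close> is
  the sum of the ranks, no such \<open>M\<close> exists. The side conditions on the parameters are not
  part of the predicate.
\<close>
definition is_Mk ::
  "int \<Rightarrow> 'a matroid \<Rightarrow> 'a set \<Rightarrow> 'a set \<Rightarrow> 'a matroid \<Rightarrow> 'a set \<Rightarrow> 'a set \<Rightarrow> 'a matroid \<Rightarrow> bool"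
  where
  "is_Mk k N1 A1 U1 N2 A2 U2 M \<longleftrightarrow>
     ground M = ground N1 \<union> ground N2 \<union> U1 \<union> U2 \<and>
     {Z. cyclic_flat M Z} =
       {{}, ground M} \<union>
       {F \<union> U1 \<union> A2 | F. F \<in> proper_cyclic_flats N1} \<union>
       {F \<union> U2 \<union> A1 | F. F \<in> proper_cyclic_flats N2} \<and>
     rk M {} = 0 \<and>
     int (rk M (ground M)) = k \<and>
     (\<forall>F\<in>proper_cyclic_flats N1. rk M (F \<union> U1 \<union> A2) = rk N1 F + card U1 + card A2) \<and>
     (\<forall>F\<in>proper_cyclic_flats N2. rk M (F \<union> U2 \<union> A1) = rk N2 F + card U2 + card A1)"

end

theory Submission
  imports Defs
begin

text \<open>
  Write \<open>V\<^sub>1 = T\<^sub>1 \<union> S\<^sub>2'\<close>. By the cyclic flats, a set \<open>X\<close> of at most \<open>k\<close> elements is independent in \<open>M\<close>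
  iff the nullity of \<open>X \<inter> S\<^sub>1\<close> in \<open>M\<^sub>1\<close> is at most \<open>card (V\<^sub>1 - X)\<close>, and symmetrically. Hence if
  \<open>A\<^sub>j\<close> and \<open>B\<^sub>j\<close> are presentations of \<open>M\<^sub>1\<close> and \<open>M\<^sub>2\<close> by as many sets as their ranks, the sets \<open>A\<^sub>j\<close>
  enlarged by everything outside \<open>S\<^sub>1 \<union> V\<^sub>1\<close>, the \<open>B\<^sub>j\<close> enlarged symmetrically, and further copies
  of the whole ground set, \<open>k\<close> sets in total, present \<open>M\<close>. Conversely \<open>M\<^sub>1\<close> is the restriction
  of \<open>M / V\<^sub>1\<close> to \<open>S\<^sub>1\<close>, and since it is contracted from a free coextension, a presentation of \<open>M\<close> can be
  turned into one of \<open>M\<^sub>1\<close>. The construction commutes with duality, which settles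
  cotransversality. For gammoids, write each \<open>M\<^sub>i\<close> as a contraction of a transversal matroid by an
  independent set \<open>X\<^sub>i\<close>, apply the construction to these with \<open>S\<^sub>i' \<union> X\<^sub>i\<close> in place of \<open>S\<^sub>i'\<close>, and
  contract \<open>X\<^sub>1 \<union> X\<^sub>2\<close>.
\<close>

section \<open>Rank\<close>

lemma card_eq_add_Diff: "X \<subseteq> Y \<Longrightarrow> finite Y \<Longrightarrow> card Y = card X + card (Y - X)"
  using card_Diff_subset [of X Y] card_mono [of Y X] finite_subset [of X Y] by auto

lemma is_matroid_indep: "is_matroid (ground M) {X. indep M X}"
  by transfer auto

lemma finite_ground [simp]: "finite (ground M)"
  and indep_empty [simp]: "indep M {}"
  and indep_subset_ground: "indep M X \<Longrightarrow> X \<subseteq> ground M"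
  and indep_subset: "indep M X \<Longrightarrow> Y \<subseteq> X \<Longrightarrow> indep M Y"
  using is_matroidD(1,2,3,4) [OF is_matroid_indep [of M]] by auto

lemma indep_finite: "indep M X \<Longrightarrow> finite X"
  using finite_subset [OF indep_subset_ground finite_ground] .

lemma matroid_eqI:
  assumes "ground M = ground N" "\<And>X. indep M X \<longleftrightarrow> indep N X"
  shows "M = N"
proof -
  obtain E I where M: "Rep_matroid M = (E, I)" by (cases "Rep_matroid M")
  obtain E' I' where N: "Rep_matroid N = (E', I')" by (cases "Rep_matroid N")
  have "E = E'" using assms(1) M N by (simp add: ground.rep_eq)
  moreover have "I = I'" using assms(2) M N by (auto simp: indep.rep_eq)
  ultimately show ?thesis using M N by (simp flip: Rep_matroid_inject)
qed

section \<open>Attainment, monotonicity and submodularity of the rank\<close>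

lemma finite_indeps: "finite {I. I \<subseteq> X \<and> indep M I}"
proof (rule finite_subset)
  show "{I. I \<subseteq> X \<and> indep M I} \<subseteq> Pow (ground M)"
    using indep_subset_ground [of M] by blast
qed simp

lemma rk_witness: "\<exists>I. I \<subseteq> X \<and> indep M I \<and> card I = rk M X"
proof -
  have "{} \<in> {I. I \<subseteq> X \<and> indep M I}" by simp
  then have "card ` {I. I \<subseteq> X \<and> indep M I} \<noteq> {}" by blast
  then have "rk M X \<in> card ` {I. I \<subseteq> X \<and> indep M I}"
    unfolding rk_def by (intro Max_in finite_imageI finite_indeps)
  then show ?thesis by auto
qed

lemma card_le_rk: "indep M I \<Longrightarrow> I \<subseteq> X \<Longrightarrow> card I \<le> rk M X"
  unfolding rk_def by (intro Max_ge finite_imageI finite_indeps) auto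

lemma indep_extend:
  assumes "indep M I" "I \<subseteq> X"
  shows "\<exists>J. I \<subseteq> J \<and> J \<subseteq> X \<and> indep M J \<and> card J = rk M X"
proof -
  obtain B where B: "B \<subseteq> X" "indep M B" "card B = rk M X"
    using rk_witness [of X M] by blast
  moreover have "I \<in> {X. indep M X}" "B \<in> {X. indep M X}" using assms B by simp_all
  ultimately have "\<exists>J\<in>{X. indep M X}. I \<subseteq> J \<and> J \<subseteq> X \<and> card B \<le> card J"
    using assms by (intro is_matroid_extend [OF is_matroid_indep])
  then obtain J where "indep M J" "I \<subseteq> J" "J \<subseteq> X" "card B \<le> card J"
    by auto
  with B card_le_rk [of M J X] show ?thesis by (intro exI [of _ J]) auto
qed

lemma rk_mono: "X \<subseteq> Y \<Longrightarrow> rk M X \<le> rk M Y"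
proof -
  assume "X \<subseteq> Y"
  obtain I where "I \<subseteq> X" "indep M I" "card I = rk M X"
    using rk_witness [of X M] by blast
  with \<open>X \<subseteq> Y\<close> card_le_rk [of M I Y] show ?thesis by auto
qed

lemma rk_le_card: "finite X \<Longrightarrow> rk M X \<le> card X"
  using rk_witness [of X M] by (auto dest: card_mono)

lemma rk_empty [simp]: "rk M {} = 0"
  using rk_le_card [of "{}" M] by simp

lemma rk_indep: "indep M X \<Longrightarrow> rk M X = card X"
  using card_le_rk [of M X X] rk_le_card [of X M] indep_finite [of M X] by force

lemma indep_iff_rk:
  assumes "finite X"
  shows "indep M X \<longleftrightarrow> rk M X = card X"
proof
  assume X: "rk M X = card X"
  obtain I where "I \<subseteq> X" "indep M I" "card I = rk M X"
    using rk_witness [of X M] by blast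
  with X assms show "indep M X" using card_subset_eq [of X I] by simp
qed (rule rk_indep)

text \<open>A basis \<open>I\<close> of \<open>X \<inter> Y\<close> grows to a basis
  \<open>J\<close> of \<open>X \<union> Y\<close>. The parts of \<open>J\<close> in \<open>X\<close>
  and in \<open>Y\<close> are independent, together cover \<open>J\<close>, and overlap at least in
  \<open>I\<close>.\<close>

lemma rk_submod: "rk M (X \<union> Y) + rk M (X \<inter> Y) \<le> rk M X + rk M Y"
proof -
  obtain I where I: "I \<subseteq> X \<inter> Y" "indep M I" "card I = rk M (X \<inter> Y)"
    using rk_witness [of "X \<inter> Y" M] by blast
  then obtain J where J: "I \<subseteq> J" "J \<subseteq> X \<union> Y" "indep M J" "card J = rk M (X \<union> Y)"
    using indep_extend [of M I "X \<union> Y"] by blast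
  note fin = indep_finite [OF J(3)]
  have "J \<inter> X \<union> J \<inter> Y = J" using J by blast
  then have "card (J \<inter> X) + card (J \<inter> Y) = card J + card ((J \<inter> X) \<inter> (J \<inter> Y))"
    using fin card_Un_Int [of "J \<inter> X" "J \<inter> Y"] by simp
  moreover have "card I \<le> card ((J \<inter> X) \<inter> (J \<inter> Y))"
    using I J fin by (intro card_mono) auto
  moreover have "card (J \<inter> X) \<le> rk M X" "card (J \<inter> Y) \<le> rk M Y"
    by (rule card_le_rk [OF indep_subset [OF J(3) Int_lower1] Int_lower2])+
  ultimately show ?thesis using I J by linarith
qed

lemma rk_Un_le: "finite Y \<Longrightarrow> rk M (X \<union> Y) \<le> rk M X + card Y"
  using rk_submod [of M X Y] rk_le_card [of Y M] by linarith

lemma rk_le_add_card: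
  assumes "finite Y"
  shows "rk M Y \<le> rk M X + card (Y - X)"
  using rk_Un_le [of "Y - X" M X] rk_mono [of Y "X \<union> (Y - X)" M] assms by auto

text \<open>Monotonicity of the nullity, with terms moved across so that no truncated subtraction on
  \<open>nat\<close> occurs.\<close>

lemma nullity_mono:
  assumes "finite Y" "X \<subseteq> Y"
  shows "card X + rk M Y \<le> card Y + rk M X"
  using rk_le_add_card [of Y M X] card_Diff_subset [of X Y] card_mono [of Y X] assms
    finite_subset [of X Y]
  by auto

lemma card_eq_rk_nullity: "finite X \<Longrightarrow> card X = rk M X + nullity M X"
  using rk_le_card [of X M] by (simp add: nullity_def)

lemma rk_le_matroid_rank: "X \<subseteq> ground N \<Longrightarrow> rk N X \<le> matroid_rank N"
  unfolding matroid_rank_def by (rule rk_mono)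

lemma nullity_subset_le:
  assumes "X \<subseteq> A" "finite A"
  shows "card X \<le> rk N X + nullity N A"
  using nullity_mono [OF assms(2,1), of N] card_eq_rk_nullity [OF assms(2), of N] by simp

text \<open>Submodularity for \<open>insert e X\<close> and \<open>Y\<close>: an element spanned by
  a set is spanned by every larger set.\<close>

lemma rk_insert_eq_mono:
  assumes "rk M (insert e X) = rk M X" "X \<subseteq> Y"
  shows "rk M (insert e Y) = rk M Y"
proof (cases "e \<in> Y")
  case False
  then have "insert e X \<union> Y = insert e Y" "insert e X \<inter> Y = X" using assms(2) by auto
  with rk_submod [of M "insert e X" Y] assms(1) rk_mono [OF subset_insertI, of M Y e]
  show ?thesis by simp
qed (simp add: insert_absorb)

lemma rk_spanned:
  assumes "finite Y" "\<And>e. e \<in> Y \<Longrightarrow> rk M (insert e X) = rk M X"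
  shows "rk M (X \<union> Y) = rk M X"
  using assms
proof (induction Y rule: finite_induct)
  case (insert y Y)
  then show ?case using rk_insert_eq_mono [of M y X "X \<union> Y"] by auto
qed simp

section \<open>Cyclic flats\<close>

text \<open>Unions of circuits, recast as the sets whose restriction has no coloop; only the rank
  function enters.\<close>

definition cyclic :: "'a matroid \<Rightarrow> 'a set \<Rightarrow> bool" where
  "cyclic M X \<longleftrightarrow> X \<subseteq> ground M \<and> (\<forall>e\<in>X. rk M (X - {e}) = rk M X)"

lemma dependent_contains_circuit:
  assumes "X \<subseteq> ground M" "\<not> indep M X"
  shows "\<exists>C\<subseteq>X. circuit M C"
proof -
  have "finite {Y. Y \<subseteq> X \<and> \<not> indep M Y}"
    using finite_subset [OF assms(1) finite_ground] by simp
  moreover have "X \<in> {Y. Y \<subseteq> X \<and> \<not> indep M Y}" using assms(2) by simp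
  ultimately have "\<exists>C\<in>{Y. Y \<subseteq> X \<and> \<not> indep M Y}. \<forall>D\<in>{Y. Y \<subseteq> X \<and> \<not> indep M Y}. D \<subseteq> C \<longrightarrow> C = D"
    by (intro finite_has_minimal) auto
  then obtain C where C: "C \<subseteq> X" "\<not> indep M C"
    "\<And>D. D \<subseteq> X \<Longrightarrow> \<not> indep M D \<Longrightarrow> D \<subseteq> C \<Longrightarrow> C = D"
    by auto
  then have "indep M D" if "D \<subset> C" for D using that by blast
  with C assms(1) show ?thesis by (auto simp: circuit_def)
qed

text \<open>If removing \<open>e\<close> keeps the rank, some basis \<open>I\<close> of
  \<open>X\<close> avoids \<open>e\<close>, and a circuit in \<open>insert e I\<close> must pass
  through \<open>e\<close>. Conversely, an element of a circuit is spanned by the rest of the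
  circuit, hence by the rest of any set containing the circuit.\<close>

lemma cyclic_iff: "cyclic M X \<longleftrightarrow> (\<exists>\<C>. (\<forall>C\<in>\<C>. circuit M C) \<and> X = \<Union>\<C>)"
proof
  assume X: "cyclic M X"
  have "\<exists>C\<subseteq>X. circuit M C \<and> e \<in> C" if "e \<in> X" for e
  proof -
    obtain I where I: "I \<subseteq> X - {e}" "indep M I" "card I = rk M X"
      using rk_witness [of "X - {e}" M] X \<open>e \<in> X\<close> by (auto simp: cyclic_def)
    have "insert e I \<subseteq> X" "e \<notin> I" using I \<open>e \<in> X\<close> by auto
    then have "\<not> indep M (insert e I)"
      using card_le_rk [of M "insert e I" X] I indep_finite [OF I(2)] by auto
    moreover have "insert e I \<subseteq> ground M" using X I \<open>e \<in> X\<close> by (auto simp: cyclic_def)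
    ultimately obtain C where "C \<subseteq> insert e I" "circuit M C"
      using dependent_contains_circuit [of "insert e I" M] by auto
    moreover from this have "e \<in> C"
      using indep_subset [OF I(2), of C] by (auto simp: circuit_def)
    ultimately show ?thesis using I \<open>e \<in> X\<close> by blast
  qed
  then have "X = \<Union>{C. C \<subseteq> X \<and> circuit M C}" by blast
  then show "\<exists>\<C>. (\<forall>C\<in>\<C>. circuit M C) \<and> X = \<Union>\<C>"
    by (intro exI [of _ "{C. C \<subseteq> X \<and> circuit M C}"]) simp
next
  assume "\<exists>\<C>. (\<forall>C\<in>\<C>. circuit M C) \<and> X = \<Union>\<C>"
  then obtain \<C> where C: "\<forall>C\<in>\<C>. circuit M C" "X = \<Union>\<C>" by blast
  have "rk M (X - {e}) = rk M X" if e: "e \<in> X" for e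
  proof -
    obtain D where D: "D \<in> \<C>" "e \<in> D" using e C by auto
    then have c: "circuit M D" "D \<subseteq> X" using C by auto
    then have fin: "finite D" using finite_subset [of D "ground M"] by (auto simp: circuit_def)
    have i: "indep M (D - {e})" using c D by (auto simp: circuit_def)
    have "rk M D \<noteq> card D" using c(1) indep_iff_rk [OF fin, of M] by (simp add: circuit_def)
    then have "rk M D < card D" using rk_le_card [OF fin, of M] by simp
    then have "rk M D \<le> rk M (D - {e})" using rk_indep [OF i] D fin by simp
    then have "rk M (insert e (D - {e})) = rk M (D - {e})"
      using rk_mono [of "D - {e}" D M] D by (simp add: insert_absorb)
    then have "rk M (insert e (X - {e})) = rk M (X - {e})"
      by (rule rk_insert_eq_mono) (use c in auto)
    then show ?thesis using e by (simp add: insert_absorb)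
  qed
  then show "cyclic M X" using C by (auto simp: cyclic_def circuit_def)
qed

lemma cyclic_flat_iff: "cyclic_flat M F \<longleftrightarrow> flat M F \<and> cyclic M F"
  by (simp only: cyclic_flat_def cyclic_iff)

text \<open>The witness is the closure of the set of non-coloops of the restriction to \<open>X\<close>.\<close>
lemma cyclic_flat_max_nullity:
  assumes "X \<subseteq> ground M"
  shows "\<exists>F. cyclic_flat M F \<and> rk M F + card (X - F) \<le> rk M X"
proof -
  define D where "D = {e \<in> X. rk M (X - {e}) = rk M X}"
  define F where "F = {e \<in> ground M. rk M (insert e D) = rk M D}"
  have finX: "finite X" using finite_subset [OF assms finite_ground] .
  have "D \<subseteq> X" by (auto simp: D_def)
  \<comment> \<open>Deleting coloops one at a time costs one unit of rank each: a coloop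
    \<open>z\<close> spanned by what remains would also be spanned by
    \<open>X - {z}\<close>.\<close>
  have coloops: "rk M (X - Z) + card Z \<le> rk M X" if "finite Z" "Z \<subseteq> X - D" for Z
    using that
  proof (induction Z rule: finite_induct)
    case (insert z Z)
    have z: "z \<in> X" "rk M (X - {z}) \<noteq> rk M X" using insert by (auto simp: D_def)
    have "rk M (X - insert z Z) \<noteq> rk M (X - Z)"
    proof
      assume "rk M (X - insert z Z) = rk M (X - Z)"
      moreover have "insert z (X - insert z Z) = X - Z" using insert z by auto
      ultimately have "rk M (insert z (X - insert z Z)) = rk M (X - insert z Z)" by simp
      then have "rk M (insert z (X - {z})) = rk M (X - {z})"
        by (rule rk_insert_eq_mono) auto
      with z show False by (simp add: insert_absorb)
    qed
    moreover have "rk M (X - insert z Z) \<le> rk M (X - Z)" by (rule rk_mono) auto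
    ultimately show ?case using insert by auto
  qed simp
  have "X - (X - D) = D" using \<open>D \<subseteq> X\<close> by auto
  then have D_rk: "rk M D + card (X - D) \<le> rk M X"
    using coloops [of "X - D"] finX by simp
  \<comment> \<open>A loss of rank at \<open>e\<close> could not be made up by the elements of
    \<open>X - D\<close>, which contribute at most one each; but
    \<open>rk M (X - {e}) = rk M X\<close>.\<close>
  have D_cyc: "rk M (D - {e}) = rk M D" if "e \<in> D" for e
  proof -
    have "X - {e} - (D - {e}) = X - D" using that by auto
    then have "rk M (X - {e}) \<le> rk M (D - {e}) + card (X - D)"
      using rk_le_add_card [of "X - {e}" M "D - {e}"] finX by auto
    moreover have "rk M (X - {e}) = rk M X" using that by (simp add: D_def)
    ultimately show ?thesis using D_rk rk_mono [of "D - {e}" D M] by force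
  qed
  have "D \<subseteq> F" using \<open>D \<subseteq> X\<close> assms by (auto simp: F_def insert_absorb)
  have "finite F" by (simp add: F_def)
  have F_rk: "rk M F = rk M D"
  proof -
    have "rk M (insert e D) = rk M D" if "e \<in> F" for e using that by (simp add: F_def)
    then have "rk M (D \<union> F) = rk M D" using \<open>finite F\<close> by (intro rk_spanned)
    then show ?thesis using \<open>D \<subseteq> F\<close> by (simp add: Un_absorb1)
  qed
  have "flat M F"
    unfolding flat_def
  proof (intro conjI ballI)
    fix e assume e: "e \<in> ground M - F"
    then have "rk M (insert e D) \<noteq> rk M D" by (auto simp: F_def)
    then have "rk M D < rk M (insert e D)" using rk_mono [of D "insert e D" M] by force
    also have "\<dots> \<le> rk M (insert e F)" using \<open>D \<subseteq> F\<close> by (intro rk_mono) auto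
    finally show "rk M F < rk M (insert e F)" by (simp add: F_rk)
  qed (auto simp: F_def)
  moreover have "cyclic M F"
    unfolding cyclic_def
  proof (intro conjI ballI)
    fix e assume "e \<in> F"
    have "rk M (D - {e}) = rk M D" using D_cyc by (cases "e \<in> D") auto
    moreover have "rk M (D - {e}) \<le> rk M (F - {e})" using \<open>D \<subseteq> F\<close> by (intro rk_mono) auto
    ultimately show "rk M (F - {e}) = rk M F"
      using F_rk rk_mono [of "F - {e}" F M] by auto
  qed (auto simp: F_def)
  moreover have "card (X - F) \<le> card (X - D)" using finX \<open>D \<subseteq> F\<close> by (intro card_mono) auto
  ultimately show ?thesis using D_rk F_rk by (intro exI [of _ F]) (auto simp: cyclic_flat_iff)
qed

text \<open>This is how cyclic flats and their ranks determine a matroid. For a suitable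
  \<open>F\<close> the rank of \<open>X\<close> is at least \<open>rk M F + card (X - F)\<close>,
  and the bound on \<open>card (X \<inter> F)\<close> raises this to \<open>card X\<close>.\<close>

lemma indep_iff_cyclic_flats:
  assumes "X \<subseteq> ground M"
  shows "indep M X \<longleftrightarrow> (\<forall>F. cyclic_flat M F \<longrightarrow> card (X \<inter> F) \<le> rk M F)"
proof
  assume "indep M X"
  then show "\<forall>F. cyclic_flat M F \<longrightarrow> card (X \<inter> F) \<le> rk M F"
    using card_le_rk [OF indep_subset [OF _ Int_lower1] Int_lower2, of M X] by blast
next
  assume *: "\<forall>F. cyclic_flat M F \<longrightarrow> card (X \<inter> F) \<le> rk M F"
  obtain F where F: "cyclic_flat M F" "rk M F + card (X - F) \<le> rk M X"
    using cyclic_flat_max_nullity [OF assms] by blast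
  have fin: "finite X" using finite_subset [OF assms finite_ground] .
  have "card X = card (X \<inter> F) + card (X - F)"
    using card_Int_Diff [OF fin, of F] .
  with F * have "card X \<le> rk M X" by fastforce
  then show "indep M X" using rk_le_card [OF fin, of M] indep_iff_rk [OF fin, of M] by simp
qed

section \<open>Duality and contraction\<close>

lemma basis_iff: "basis M B \<longleftrightarrow> indep M B \<and> card B = matroid_rank M"
proof
  assume B: "basis M B"
  then obtain J where "B \<subseteq> J" "indep M J" "card J = rk M (ground M)"
    using indep_extend [of M B "ground M"] indep_subset_ground [of M B]
    by (auto simp: basis_def)
  with B show "indep M B \<and> card B = matroid_rank M"
    by (auto simp: basis_def matroid_rank_def)
next
  assume B: "indep M B \<and> card B = matroid_rank M"
  have "X = B" if "indep M X" "B \<subseteq> X" for X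
    using card_le_rk [OF that(1) indep_subset_ground [OF that(1)]] B that
      card_seteq [OF indep_finite [OF that(1)] that(2)] by (simp add: matroid_rank_def)
  with B show "basis M B" by (auto simp: basis_def)
qed

lemma indep_dual_iff_rk:
  "indep (dual M) X \<longleftrightarrow> X \<subseteq> ground M \<and> rk M (ground M - X) = matroid_rank M"
proof -
  have "(\<exists>B. basis M B \<and> B \<inter> X = {}) \<longleftrightarrow> rk M (ground M - X) = matroid_rank M"
  proof
    assume "\<exists>B. basis M B \<and> B \<inter> X = {}"
    then obtain B where B: "indep M B" "card B = matroid_rank M" "B \<inter> X = {}"
      by (auto simp: basis_iff)
    then have "matroid_rank M \<le> rk M (ground M - X)"
      using card_le_rk [of M B "ground M - X"] indep_subset_ground [of M B] by auto
    then show "rk M (ground M - X) = matroid_rank M"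
      using rk_mono [of "ground M - X" "ground M" M] by (simp add: matroid_rank_def)
  next
    assume "rk M (ground M - X) = matroid_rank M"
    then show "\<exists>B. basis M B \<and> B \<inter> X = {}"
      using rk_witness [of "ground M - X" M] by (auto simp: basis_iff)
  qed
  then show ?thesis by (auto simp: indep_dual)
qed

text \<open>Upper bound: a maximal coindependent \<open>I\<close> in \<open>X\<close> has a spanning
  complement, whose rank exceeds that of \<open>ground M - X\<close> by at most
  \<open>card (X - I)\<close>. Lower bound: extend a basis of \<open>ground M - X\<close> to a basis
  \<open>B\<close> of \<open>M\<close>; then \<open>X - B\<close> is coindependent.\<close>

lemma rk_dual:
  assumes "X \<subseteq> ground M"
  shows "rk (dual M) X + matroid_rank M = card X + rk M (ground M - X)"
proof (rule antisym)
  have fin: "finite X" using finite_subset [OF assms finite_ground] .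
  show "rk (dual M) X + matroid_rank M \<le> card X + rk M (ground M - X)"
  proof -
    obtain I where I: "I \<subseteq> X" "indep (dual M) I" "card I = rk (dual M) X"
      using rk_witness [of X "dual M"] by blast
    have "ground M - I - (ground M - X) = X - I" using assms by auto
    then have "matroid_rank M \<le> rk M (ground M - X) + card (X - I)"
      using rk_le_add_card [of "ground M - I" M "ground M - X"] I
      by (simp add: indep_dual_iff_rk)
    moreover have "card X = card I + card (X - I)"
      using I fin by (intro card_eq_add_Diff)
    ultimately show ?thesis using I by simp
  qed
  obtain J where J: "J \<subseteq> ground M - X" "indep M J" "card J = rk M (ground M - X)"
    using rk_witness [of "ground M - X" M] by blast
  then obtain B where B: "J \<subseteq> B" "B \<subseteq> ground M" "indep M B" "card B = matroid_rank M"
    using indep_extend [of M J "ground M"] by (auto simp: matroid_rank_def)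
  have "indep (dual M) (X - B)"
    using B assms by (auto simp: indep_dual basis_iff)
  then have "card (X - B) \<le> rk (dual M) X" by (rule card_le_rk) auto
  moreover have "card B = card (B \<inter> X) + card (B - X)"
    using card_Int_Diff [OF indep_finite [OF B(3)], of X] .
  moreover have "card J \<le> card (B - X)"
    using B J indep_finite [OF B(3)] by (intro card_mono) auto
  moreover have "card (B - X) \<le> rk M (ground M - X)"
    using B indep_subset [OF B(3), of "B - X"] by (intro card_le_rk) auto
  moreover have "card X = card (B \<inter> X) + card (X - B)"
    using card_Int_Diff [OF fin, of B] by (simp add: inf_commute)
  ultimately show "card X + rk M (ground M - X) \<le> rk (dual M) X + matroid_rank M"
    using B(4) J(3) by linarith
qed

lemma matroid_rank_dual: "matroid_rank (dual M) + matroid_rank M = card (ground M)"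
  using rk_dual [of "ground M" M] by (simp add: matroid_rank_def)

lemma dual_dual [simp]: "dual (dual M) = M"
proof (rule matroid_eqI)
  fix X
  show "indep (dual (dual M)) X \<longleftrightarrow> indep M X"
  proof (cases "X \<subseteq> ground M")
    case True
    then have "ground M - (ground M - X) = X" by auto
    then have "rk (dual M) (ground M - X) + matroid_rank M = card (ground M - X) + rk M X"
      using rk_dual [of "ground M - X" M] by simp
    moreover have "card (ground M) = card X + card (ground M - X)"
      using True by (intro card_eq_add_Diff) auto
    moreover have "finite X" using True by (rule finite_subset) simp
    ultimately show ?thesis
      using True matroid_rank_dual [of M] by (auto simp: indep_dual_iff_rk indep_iff_rk)
  next
    case False
    then show ?thesis
      using indep_subset_ground [of M X] indep_subset_ground [of "dual (dual M)" X] by auto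
  qed
qed simp

text \<open>By \<open>rk_dual\<close>, removing \<open>e\<close> from \<open>F\<close> keeps the
  rank exactly when adding \<open>e\<close> to the complement raises the dual rank. Complementation
  thus exchanges the conditions for being a flat and for being cyclic.\<close>

lemma cyclic_flat_dual:
  assumes "cyclic_flat M F"
  shows "cyclic_flat (dual M) (ground M - F)"
proof -
  let ?E = "ground M"
  have F: "F \<subseteq> ?E" "\<And>e. e \<in> ?E - F \<Longrightarrow> rk M F < rk M (insert e F)"
    "\<And>e. e \<in> F \<Longrightarrow> rk M (F - {e}) = rk M F"
    using assms by (auto simp: cyclic_flat_iff flat_def cyclic_def)
  have 0: "rk (dual M) (?E - F) + matroid_rank M = card (?E - F) + rk M F"
    using rk_dual [of "?E - F" M] F(1) by (simp add: double_diff)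
  have "rk (dual M) (?E - F) < rk (dual M) (insert e (?E - F))" if "e \<in> ?E - (?E - F)" for e
  proof -
    have e: "e \<in> F" using that by auto
    have "?E - insert e (?E - F) = F - {e}" using F(1) by auto
    moreover have "insert e (?E - F) \<subseteq> ?E" using e F(1) by auto
    ultimately have "rk (dual M) (insert e (?E - F)) + matroid_rank M =
        card (insert e (?E - F)) + rk M F"
      using rk_dual [of "insert e (?E - F)" M] F(3) [OF e] by simp
    with 0 e show ?thesis by simp
  qed
  moreover have "rk (dual M) (?E - F - {e}) = rk (dual M) (?E - F)" if "e \<in> ?E - F" for e
  proof -
    have "?E - (?E - F - {e}) = insert e F" using F(1) that by auto
    then have "rk (dual M) (?E - F - {e}) + matroid_rank M =
        card (?E - F - {e}) + rk M (insert e F)"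
      using rk_dual [of "?E - F - {e}" M] by auto
    moreover have "card (?E - F) = Suc (card (?E - F - {e}))"
      using that by (intro card.remove) auto
    moreover have "rk (dual M) (?E - F - {e}) \<le> rk (dual M) (?E - F)" by (rule rk_mono) auto
    ultimately show ?thesis using 0 F(2) [OF that] by linarith
  qed
  ultimately show ?thesis by (auto simp: cyclic_flat_iff flat_def cyclic_def)
qed

lemma cyclic_flat_dual_iff:
  "cyclic_flat (dual M) X \<longleftrightarrow> X \<subseteq> ground M \<and> cyclic_flat M (ground M - X)"
proof
  assume X: "cyclic_flat (dual M) X"
  then show "X \<subseteq> ground M \<and> cyclic_flat M (ground M - X)"
    using cyclic_flat_dual [OF X] by (auto simp: cyclic_flat_iff cyclic_def)
next
  assume "X \<subseteq> ground M \<and> cyclic_flat M (ground M - X)"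
  then show "cyclic_flat (dual M) X"
    using cyclic_flat_dual [of M "ground M - X"] by (simp add: double_diff)
qed

lemma proper_cyclic_flats_dual:
  "proper_cyclic_flats (dual N) = (\<lambda>F. ground N - F) ` proper_cyclic_flats N"
proof (intro equalityI subsetI)
  fix F assume "F \<in> proper_cyclic_flats (dual N)"
  then have "F \<subseteq> ground N" "ground N - F \<in> proper_cyclic_flats N"
    by (auto simp: proper_cyclic_flats_def cyclic_flat_dual_iff)
  then show "F \<in> (\<lambda>F. ground N - F) ` proper_cyclic_flats N"
    by (intro image_eqI [of _ _ "ground N - F"]) auto
next
  fix F assume "F \<in> (\<lambda>F. ground N - F) ` proper_cyclic_flats N"
  then obtain F' where F': "F = ground N - F'" "cyclic_flat N F'" "F' \<noteq> {}" "F' \<noteq> ground N"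
    by (auto simp: proper_cyclic_flats_def)
  then have "F' \<subseteq> ground N" by (simp add: cyclic_flat_def flat_def)
  with F' show "F \<in> proper_cyclic_flats (dual N)"
    by (auto simp: proper_cyclic_flats_def cyclic_flat_dual)
qed

lemma proper_cyclic_flat_subset: "F \<in> proper_cyclic_flats N \<Longrightarrow> F \<subseteq> ground N"
  by (simp add: proper_cyclic_flats_def cyclic_flat_def flat_def)

text \<open>Serves to translate the lower bound on \<open>k\<close> to the dual matroids.\<close>

lemma nullity_dual:
  assumes "A \<subseteq> ground N"
  shows "nullity (dual N) (ground N - A) + rk N A = matroid_rank N"
proof -
  have "rk (dual N) (ground N - A) + matroid_rank N = card (ground N - A) + rk N A"
    using rk_dual [of "ground N - A" N] assms by (simp add: double_diff)
  moreover have "rk N A \<le> matroid_rank N" using assms by (rule rk_le_matroid_rank)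
  ultimately show ?thesis by (simp add: nullity_def)
qed

section \<open>Deletion and contraction\<close>

lemma rk_delete: "Y \<subseteq> ground M - X \<Longrightarrow> rk (delete M X) Y = rk M Y"
  unfolding rk_def by (rule arg_cong [where f = "\<lambda>S. Max (card ` S)"]) (auto simp: indep_delete)

lemma ground_contract [simp]: "ground (contract M X) = ground M - X"
  by (simp add: contract_def)

text \<open>The dual rank formula turns independence in the contraction into
  \<open>rk M (X \<union> Z) = card Z + rk M X\<close>. The basis \<open>B\<close> spans
  \<open>X\<close>, so \<open>Z \<union> B\<close> has the same rank as
  \<open>X \<union> Z\<close>.\<close>

lemma indep_contract:
  assumes "X \<subseteq> ground M" "B \<subseteq> X" "indep M B" "card B = rk M X"
  shows "indep (contract M X) Z \<longleftrightarrow> Z \<subseteq> ground M - X \<and> indep M (Z \<union> B)"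
proof (cases "Z \<subseteq> ground M - X")
  case True
  let ?E = "ground M"
  have fin: "finite Z" "finite B"
    using True finite_subset [of Z ?E] indep_finite [OF assms(3)] by auto
  have eq: "?E - (?E - X - Z) = X \<union> Z" "?E - (?E - X) = X" using True assms(1) by auto
  have "rk (dual M) (?E - X - Z) + matroid_rank M = card (?E - X - Z) + rk M (X \<union> Z)"
    "rk (dual M) (?E - X) + matroid_rank M = card (?E - X) + rk M X"
    using rk_dual [of "?E - X - Z" M] rk_dual [of "?E - X" M] by (auto simp: eq)
  moreover have "card (?E - X) = card Z + card (?E - X - Z)"
    using True by (intro card_eq_add_Diff) auto
  moreover have "indep (contract M X) Z \<longleftrightarrow> rk (dual M) (?E - X - Z) = rk (dual M) (?E - X)"
    using True by (auto simp: contract_def indep_dual_iff_rk matroid_rank_def rk_delete)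
  moreover have "rk M (Z \<union> B) = rk M (X \<union> Z)"
  proof -
    have "rk M B = rk M X" using assms rk_indep by metis
    then have "rk M (insert e B) = rk M B" if "e \<in> X" for e
      using that rk_mono [OF subset_insertI, of M B e] rk_mono [of "insert e B" X M] assms(2)
      by simp
    then have "rk M (insert e (Z \<union> B)) = rk M (Z \<union> B)" if "e \<in> X" for e
      using that rk_insert_eq_mono [of M e B "Z \<union> B"] by auto
    then have "rk M (Z \<union> B \<union> X) = rk M (Z \<union> B)"
      using assms(1) by (intro rk_spanned) (auto intro: finite_subset)
    moreover have "Z \<union> B \<union> X = X \<union> Z" using assms(2) by auto
    ultimately show ?thesis by simp
  qed
  moreover have "card (Z \<union> B) = card Z + card B"
    using fin True assms(2) by (intro card_Un_disjoint) auto
  ultimately show ?thesis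
    using True indep_iff_rk [of "Z \<union> B" M] fin assms(4) by auto
next
  case False
  then show ?thesis using indep_subset_ground [of "contract M X" Z] by auto
qed

section \<open>Partial transversals\<close>

lemma hall:
  fixes N :: "'a \<Rightarrow> 'b set"
  assumes "finite X" "\<And>x. x \<in> X \<Longrightarrow> finite (N x)"
    and "\<And>Y. Y \<subseteq> X \<Longrightarrow> card Y \<le> card (\<Union> (N ` Y))"
  shows "\<exists>f. inj_on f X \<and> (\<forall>x\<in>X. f x \<in> N x)"
  using assms
proof (induction X arbitrary: N rule: finite_psubset_induct)
  case (psubset X)
  note IH = psubset.IH and fin = psubset.prems(1) and H = psubset.prems(2)
  have finN: "finite (\<Union> (N ` Y))" if "Y \<subseteq> X" for Y
    using that fin psubset.hyps(1) finite_subset [OF that] by auto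
  show ?case
  proof (cases "\<exists>Y. Y \<noteq> {} \<and> Y \<subset> X \<and> card (\<Union> (N ` Y)) \<le> card Y")
    case True
    then obtain Y where Y: "Y \<noteq> {}" "Y \<subset> X" "card (\<Union> (N ` Y)) \<le> card Y" by blast
    have "\<exists>f. inj_on f Y \<and> (\<forall>x\<in>Y. f x \<in> N x)"
      using Y by (intro IH) (auto intro!: fin H)
    then obtain f where f: "inj_on f Y" "\<forall>x\<in>Y. f x \<in> N x"
      by (elim exE conjE) (rule that)
    let ?U = "\<Union> (N ` Y)"
    \<comment> \<open>Hall's condition survives the removal of \<open>?U\<close>: apply it to
      \<open>Z \<union> Y\<close> and subtract the tight set \<open>Y\<close>.\<close>
    have "\<exists>g. inj_on g (X - Y) \<and> (\<forall>x\<in>X - Y. g x \<in> N x - ?U)"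
    proof (rule IH)
      fix Z assume Z: "Z \<subseteq> X - Y"
      have "finite Y" "finite Z" using Y Z psubset.hyps(1) finite_subset by blast+
      then have "card Z + card Y = card (Z \<union> Y)"
        using Z by (intro card_Un_disjoint [symmetric]) auto
      also have "\<dots> \<le> card (\<Union> (N ` (Z \<union> Y)))" using Y Z by (intro H) auto
      also have "\<Union> (N ` (Z \<union> Y)) = (\<Union>x\<in>Z. N x - ?U) \<union> ?U" by auto
      also have "card \<dots> \<le> card (\<Union>x\<in>Z. N x - ?U) + card ?U" by (rule card_Un_le)
      finally show "card Z \<le> card (\<Union>x\<in>Z. N x - ?U)" using Y(3) by simp
    qed (use Y fin in auto)
    then obtain g where g: "inj_on g (X - Y)" "\<forall>x\<in>X - Y. g x \<in> N x - ?U"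
      by (elim exE conjE) (rule that)
    let ?h = "\<lambda>x. if x \<in> Y then f x else g x"
    have "inj_on ?h X"
    proof (rule inj_onI)
      fix x y assume xy: "x \<in> X" "y \<in> X" "?h x = ?h y"
      have "x \<in> Y \<longleftrightarrow> y \<in> Y" using xy bspec [OF f(2), of x] bspec [OF f(2), of y] bspec [OF g(2), of x] bspec [OF g(2), of y]
        by (auto split: if_splits)
      then show "x = y" using xy f(1) g(1) by (auto simp: inj_on_def split: if_splits)
    qed
    moreover have "\<forall>x\<in>X. ?h x \<in> N x" using f(2) g(2) by auto
    ultimately show ?thesis by blast
  next
    case False
    show ?thesis
    proof (cases "X = {}")
      case ne: False
      then obtain x where x: "x \<in> X" by blast
      have "card {x} \<le> card (N x)" using H [of "{x}"] x by simp
      then obtain y where y: "y \<in> N x" using card.empty by fastforce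
      have "\<exists>f. inj_on f (X - {x}) \<and> (\<forall>z\<in>X - {x}. f z \<in> N z - {y})"
      proof (rule IH)
        fix Z assume Z: "Z \<subseteq> X - {x}"
        show "card Z \<le> card (\<Union>z\<in>Z. N z - {y})"
        proof (cases "Z = {}")
          case neZ: False
          have "card Z < card (\<Union> (N ` Z))"
          proof (rule ccontr)
            assume "\<not> ?thesis"
            then have "Z \<noteq> {} \<and> Z \<subset> X \<and> card (\<Union> (N ` Z)) \<le> card Z"
              using neZ Z x by auto
            then show False by (rule notE [OF False, OF exI])
          qed
          moreover have "(\<Union>z\<in>Z. N z - {y}) = \<Union> (N ` Z) - {y}" by auto
          moreover have "card (\<Union> (N ` Z)) \<le> Suc (card (\<Union> (N ` Z) - {y}))"
            unfolding card_Diff_singleton_if by (split if_split) (intro conjI impI; linarith)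
          ultimately show ?thesis by simp
        qed simp
      qed (use x fin in auto)
      then obtain f where f: "inj_on f (X - {x})" "\<forall>z\<in>X - {x}. f z \<in> N z - {y}"
        by (elim exE conjE) (rule that)
      have "inj_on (f(x := y)) X"
      proof (rule inj_onI)
        fix u v assume "u \<in> X" "v \<in> X" "(f(x := y)) u = (f(x := y)) v"
        then show "u = v" using f(1) bspec [OF f(2), of u] bspec [OF f(2), of v]
          by (auto simp: inj_on_def split: if_splits)
      qed
      moreover have "\<forall>z\<in>X. (f(x := y)) z \<in> N z" using f(2) y by auto
      ultimately show ?thesis by blast
    qed simp
  qed
qed

text \<open>The neighbourhood of \<open>X\<close> in the bipartite graph of elements and indices, as
  it occurs in Hall's condition.\<close>

definition meeting :: "nat \<Rightarrow> (nat \<Rightarrow> 'a set) \<Rightarrow> 'a set \<Rightarrow> nat set" where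
  "meeting n A X = {j. j < n \<and> A j \<inter> X \<noteq> {}}"

lemma finite_meeting [simp]: "finite (meeting n A X)"
  by (simp add: meeting_def)

lemma meeting_mono: "X \<subseteq> Y \<Longrightarrow> meeting n A X \<subseteq> meeting n A Y"
  by (auto simp: meeting_def)

lemma partial_transversal_card_meeting:
  assumes "partial_transversal n A X"
  shows "card X \<le> card (meeting n A X)"
proof -
  obtain f where f: "inj_on f X" "\<And>x. x \<in> X \<Longrightarrow> f x < n \<and> x \<in> A (f x)"
    using assms by (auto simp: partial_transversal_def)
  have "f ` X \<subseteq> meeting n A X"
    using f(2) by (fastforce simp: meeting_def)
  then show ?thesis using card_inj_on_le [OF f(1)] by simp
qed

lemma partial_transversal_subset:
  "partial_transversal n A X \<Longrightarrow> Y \<subseteq> X \<Longrightarrow> partial_transversal n A Y"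
  unfolding partial_transversal_def by (meson inj_on_subset subsetD)

lemma partial_transversal_iff_card_meeting:
  assumes "finite X"
  shows "partial_transversal n A X \<longleftrightarrow> (\<forall>Y\<subseteq>X. card Y \<le> card (meeting n A Y))"
proof
  assume "partial_transversal n A X"
  then show "\<forall>Y\<subseteq>X. card Y \<le> card (meeting n A Y)"
    using partial_transversal_subset partial_transversal_card_meeting by blast
next
  assume *: "\<forall>Y\<subseteq>X. card Y \<le> card (meeting n A Y)"
  have "\<Union> ((\<lambda>x. {j. j < n \<and> x \<in> A j}) ` Y) = meeting n A Y" for Y
    by (auto simp: meeting_def)
  then have "\<exists>f. inj_on f X \<and> (\<forall>x\<in>X. f x \<in> {j. j < n \<and> x \<in> A j})"
    using * by (intro hall assms) auto
  then show "partial_transversal n A X" by (auto simp: partial_transversal_def)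
qed

lemma partial_transversal_cong:
  assumes "\<And>j. A j \<inter> X = B j \<inter> X"
  shows "partial_transversal n A X \<longleftrightarrow> partial_transversal n B X"
proof -
  have "x \<in> A j \<longleftrightarrow> x \<in> B j" if "x \<in> X" for x j using assms [of j] that by blast
  then show ?thesis unfolding partial_transversal_def by (intro ex_cong1) auto
qed

text \<open>Carries presentations along relabellings; with preimages, injectivity on
  \<open>W\<close> alone is enough.\<close>

lemma partial_transversal_vimage:
  assumes "inj_on h W"
  shows "partial_transversal n (\<lambda>j. h -` A j) W \<longleftrightarrow> partial_transversal n A (h ` W)"
proof
  assume "partial_transversal n (\<lambda>j. h -` A j) W"
  then obtain f where f: "inj_on f W" "\<And>x. x \<in> W \<Longrightarrow> f x < n \<and> h x \<in> A (f x)"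
    by (auto simp: partial_transversal_def)
  have "inj_on (f \<circ> inv_into W h) (h ` W)"
    using f(1) assms by (auto simp: inj_on_def)
  moreover have "\<forall>y\<in>h ` W. (f \<circ> inv_into W h) y < n \<and> y \<in> A ((f \<circ> inv_into W h) y)"
    using f(2) assms by auto
  ultimately show "partial_transversal n A (h ` W)"
    unfolding partial_transversal_def by blast
next
  assume "partial_transversal n A (h ` W)"
  then obtain f where f: "inj_on f (h ` W)" "\<And>x. x \<in> W \<Longrightarrow> f (h x) < n \<and> h x \<in> A (f (h x))"
    by (auto simp: partial_transversal_def)
  then have "inj_on (f \<circ> h) W" using assms by (intro comp_inj_on)
  with f(2) show "partial_transversal n (\<lambda>j. h -` A j) W"
    unfolding partial_transversal_def by (intro exI [of _ "f \<circ> h"]) auto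
qed

text \<open>Induction on the number of elements of \<open>X \<inter> Y\<close> that the two matchings treat differently.\<close>
lemma partial_transversal_augment:
  assumes "finite X" "finite Y" "card X < card Y"
    and "partial_transversal n A X" "partial_transversal n A Y"
  shows "\<exists>y\<in>Y - X. partial_transversal n A (insert y X)"
proof -
  obtain f where f: "inj_on f X" "\<forall>x\<in>X. f x < n \<and> x \<in> A (f x)"
    using assms(4) by (auto simp: partial_transversal_def)
  obtain g where g: "inj_on g Y" "\<forall>x\<in>Y. g x < n \<and> x \<in> A (g x)"
    using assms(5) by (auto simp: partial_transversal_def)
  from f show ?thesis
  proof (induction "card {x \<in> X \<inter> Y. f x \<noteq> g x}" arbitrary: f rule: less_induct)
    case less
    have "card (f ` X) < card (g ` Y)"
      using assms(3) less.prems(1) g(1) by (simp add: card_image)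
    then have "\<not> g ` Y \<subseteq> f ` X"
      using assms(1) card_mono [of "f ` X" "g ` Y"] by auto
    then obtain y where y: "y \<in> Y" "g y \<notin> f ` X" by blast
    let ?f = "f(y := g y)"
    have inj: "inj_on ?f (insert y X)"
    proof (rule inj_onI)
      fix u v assume uv: "u \<in> insert y X" "v \<in> insert y X" "?f u = ?f v"
      have "f x \<noteq> g y" if "x \<in> X" for x using y(2) that by force
      with uv have "u = y \<longleftrightarrow> v = y" by (auto split: if_splits)
      with uv less.prems(1) show "u = v" by (auto dest: inj_onD split: if_splits)
    qed
    have mem: "\<forall>x\<in>insert y X. ?f x < n \<and> x \<in> A (?f x)"
      using less.prems(2) g(2) y(1) by auto
    show ?case
    proof (cases "y \<in> X")
      case True
      \<comment> \<open>Moving \<open>y\<close> to the free index \<open>g y\<close> keeps a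
        matching of \<open>X\<close> and makes it agree with \<open>g\<close> at one more
        element.\<close>
      have "{x \<in> X \<inter> Y. ?f x \<noteq> g x} \<subset> {x \<in> X \<inter> Y. f x \<noteq> g x}"
        using True y by force
      then have "card {x \<in> X \<inter> Y. ?f x \<noteq> g x} < card {x \<in> X \<inter> Y. f x \<noteq> g x}"
        using assms(1) by (intro psubset_card_mono) auto
      then show ?thesis
        using less.hyps [of ?f] inj mem True by (simp add: insert_absorb)
    next
      case False
      then have "partial_transversal n A (insert y X)"
        unfolding partial_transversal_def using inj mem by blast
      with False y show ?thesis by blast
    qed
  qed
qed

section \<open>Transversal matroids\<close>

text \<open>The theorem of Edmonds and Fulkerson; the exchange axiom is
  \<open>partial_transversal_augment\<close>.\<close>

lemma transversal_matroid_exists: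
  assumes "finite E"
  shows "\<exists>M. ground M = E \<and> (\<forall>X. indep M X \<longleftrightarrow> X \<subseteq> E \<and> partial_transversal n A X)"
proof -
  let ?I = "{X. X \<subseteq> E \<and> partial_transversal n A X}"
  have "is_matroid E ?I"
    unfolding is_matroid_def
  proof (intro conjI ballI allI impI)
    show "{} \<in> ?I" by (simp add: partial_transversal_def)
  next
    fix X Y assume XY: "X \<in> ?I" "Y \<in> ?I" "card X < card Y"
    then have "finite X" "finite Y" using assms finite_subset by auto
    with XY have "\<exists>y\<in>Y - X. partial_transversal n A (insert y X)"
      by (intro partial_transversal_augment) auto
    with XY show "\<exists>y\<in>Y - X. insert y X \<in> ?I" by auto
  qed (use assms partial_transversal_subset in auto)
  then have "Rep_matroid (Abs_matroid (E, ?I)) = (E, ?I)" by (simp add: Abs_matroid_inverse)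
  then show ?thesis
    by (intro exI [of _ "Abs_matroid (E, ?I)"]) (simp add: ground.rep_eq indep.rep_eq)
qed

text \<open>The sets \<open>A j\<close> may reach outside the ground set: cutting them down does not
  affect the matchings of its subsets.\<close>

lemma transversalI:
  assumes "\<And>X. X \<subseteq> ground M \<Longrightarrow> indep M X \<longleftrightarrow> partial_transversal n A X"
  shows "transversal M"
proof -
  let ?A = "\<lambda>j. A j \<inter> ground M"
  have "indep M X \<longleftrightarrow> partial_transversal n ?A X" for X
  proof (cases "X \<subseteq> ground M")
    case True
    then have "partial_transversal n A X \<longleftrightarrow> partial_transversal n ?A X"
      by (intro partial_transversal_cong) auto
    with assms True show ?thesis by simp
  next
    case False
    then have "\<not> partial_transversal n ?A X" by (auto simp: partial_transversal_def)
    with False indep_subset_ground [of M X] show ?thesis by blast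
  qed
  then show ?thesis unfolding transversal_def by (intro exI [of _ n] exI [of _ ?A]) simp
qed

text \<open>The index set matched to one fixed basis can be matched to every basis, by Hall's theorem.\<close>
lemma transversal_rank_presentation:
  assumes "transversal M"
  shows "\<exists>A. (\<forall>j<matroid_rank M. A j \<subseteq> ground M) \<and>
    (\<forall>X. indep M X \<longleftrightarrow> partial_transversal (matroid_rank M) A X)"
proof -
  let ?r = "matroid_rank M"
  obtain n A where A: "\<forall>j<n. A j \<subseteq> ground M" "\<And>X. indep M X \<longleftrightarrow> partial_transversal n A X"
    using assms by (auto simp: transversal_def)
  obtain B where B: "B \<subseteq> ground M" "indep M B" "card B = ?r"
    using rk_witness [of "ground M" M] by (auto simp: matroid_rank_def)
  have finB: "finite B" using indep_finite [OF B(2)] .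
  obtain g where g: "inj_on g B" "\<And>b. b \<in> B \<Longrightarrow> g b < n \<and> b \<in> A (g b)"
    using B(2) A(2) [of B] by (auto simp: partial_transversal_def)
  have "card (g ` B) = ?r" using g(1) B(3) by (simp add: card_image)
  then obtain h where h: "bij_betw h {0..<?r} (g ` B)"
    using ex_bij_betw_nat_finite [of "g ` B"] finB by auto
  then have h_inj: "inj_on h {0..<?r}" and h_im: "h ` {0..<?r} = g ` B"
    by (auto simp: bij_betw_def)
  have h_n: "h j < n" if "j < ?r" for j
  proof -
    have "h j \<in> h ` {0..<?r}" using that by simp
    then show ?thesis using g(2) unfolding h_im by auto
  qed
  let ?A = "A \<circ> h"
  have "indep M X \<longleftrightarrow> partial_transversal ?r ?A X" for X
  proof
    assume "partial_transversal ?r ?A X"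
    then obtain f where f: "inj_on f X" "\<And>x. x \<in> X \<Longrightarrow> f x < ?r \<and> x \<in> A (h (f x))"
      by (auto simp: partial_transversal_def)
    have "inj_on h (f ` X)" using h_inj by (rule inj_on_subset) (use f(2) in auto)
    then have "inj_on (h \<circ> f) X" using f(1) by (intro comp_inj_on)
    then have "partial_transversal n A X"
      unfolding partial_transversal_def using f(2) h_n by (intro exI [of _ "h \<circ> f"]) auto
    then show "indep M X" using A(2) by blast
  next
    assume X: "indep M X"
    have "card Y \<le> card (meeting ?r ?A Y)" if "Y \<subseteq> X" for Y
    proof (rule ccontr)
      assume less: "\<not> ?thesis"
      have Y: "indep M Y" using indep_subset [OF X that] .
      then obtain f where f: "inj_on f Y" "\<And>y. y \<in> Y \<Longrightarrow> f y < n \<and> y \<in> A (f y)"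
        using A(2) [of Y] by (auto simp: partial_transversal_def)
      \<comment> \<open>Elements of \<open>B\<close> whose matched set misses \<open>Y\<close>. The
        indices used by \<open>f\<close> on \<open>Y\<close> and by \<open>g\<close> on
        \<open>C\<close> are distinct, so \<open>Y \<union> C\<close> is independent and
        \<open>card Y \<le> card (B - C)\<close>. Since \<open>g\<close> sends \<open>B - C\<close>
        to indices meeting \<open>Y\<close>, Hall's condition cannot fail.\<close>
      define C where "C = {b \<in> B. A (g b) \<inter> Y = {}}"
      have disj: "Y \<inter> C = {}" using g(2) by (auto simp: C_def)
      let ?k = "\<lambda>x. if x \<in> Y then f x else g x"
      have "inj_on ?k (Y \<union> C)"
      proof (rule inj_onI)
        fix u v assume uv: "u \<in> Y \<union> C" "v \<in> Y \<union> C" "?k u = ?k v"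
        have "f y \<noteq> g c" if "y \<in> Y" "c \<in> C" for y c
          using that f(2) [of y] by (auto simp: C_def)
        then have "u \<in> Y \<longleftrightarrow> v \<in> Y" using uv by (auto split: if_splits) metis
        then show "u = v"
          using uv f(1) g(1) by (auto simp: inj_on_def C_def split: if_splits)
      qed
      moreover have "\<forall>x\<in>Y \<union> C. ?k x < n \<and> x \<in> A (?k x)"
        using f(2) g(2) by (auto simp: C_def)
      ultimately have "indep M (Y \<union> C)" using A(2) unfolding partial_transversal_def by blast
      then have "card (Y \<union> C) \<le> ?r"
        unfolding matroid_rank_def by (intro card_le_rk indep_subset_ground)
      moreover have "card (Y \<union> C) = card Y + card C"
        using disj finB indep_finite [OF Y] by (intro card_Un_disjoint) (auto simp: C_def)
      moreover have "card B = card C + card (B - C)"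
        using finB by (intro card_eq_add_Diff) (auto simp: C_def)
      moreover have "card (B - C) \<le> card (meeting ?r ?A Y)"
      proof -
        have "g ` (B - C) \<subseteq> h ` meeting ?r ?A Y"
        proof
          fix i assume "i \<in> g ` (B - C)"
          then obtain b where b: "b \<in> B" "A (g b) \<inter> Y \<noteq> {}" "i = g b" by (auto simp: C_def)
          then have "i \<in> h ` {0..<?r}" unfolding h_im by blast
          then obtain j where "j < ?r" "i = h j" by auto
          with b show "i \<in> h ` meeting ?r ?A Y"
            by (intro image_eqI [of _ _ j]) (auto simp: meeting_def)
        qed
        then have "card (g ` (B - C)) \<le> card (h ` meeting ?r ?A Y)"
          by (intro card_mono) auto
        moreover have "card (g ` (B - C)) = card (B - C)"
          using g(1) by (intro card_image) (auto simp: inj_on_def)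
        moreover have "card (h ` meeting ?r ?A Y) \<le> card (meeting ?r ?A Y)"
          by (intro card_image_le) simp
        ultimately show ?thesis by simp
      qed
      ultimately show False using less B(3) by linarith
    qed
    then show "partial_transversal ?r ?A X"
      using partial_transversal_iff_card_meeting [OF indep_finite [OF X]] by blast
  qed
  moreover have "\<forall>j<?r. ?A j \<subseteq> ground M" using A(1) h_n by simp
  ultimately show ?thesis by blast
qed

lemma rk_le_card_meeting:
  assumes "\<And>X. indep M X \<longleftrightarrow> partial_transversal n A X"
  shows "rk M X \<le> card (meeting n A X)"
proof -
  obtain I where I: "I \<subseteq> X" "indep M I" "card I = rk M X"
    using rk_witness [of X M] by blast
  then have "card I \<le> card (meeting n A I)"
    using assms partial_transversal_card_meeting by blast
  also have "\<dots> \<le> card (meeting n A X)" using I by (intro card_mono meeting_mono) auto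
  finally show ?thesis using I by simp
qed

section \<open>Gammoids\<close>

text \<open>The image of \<open>c\<close> is where the contracted elements are to be placed.\<close>
lemma gammoidE:
  fixes M :: "'a matroid" and c :: "nat \<Rightarrow> nat"
  assumes "gammoid M" "inj c"
  obtains n A X where "finite X" "X \<subseteq> range c"
    "\<forall>Z\<subseteq>ground M.
      indep M Z \<longleftrightarrow> partial_transversal n A (Inl ` Z \<union> Inr ` X :: ('a + nat) set)"
proof -
  obtain T N :: "nat matroid" where TN: "transversal T" "minor_of N T" "isomorphic M N"
    using assms(1) by (auto simp: gammoid_def)
  obtain n A where A: "\<And>X. indep T X \<longleftrightarrow> partial_transversal n A X"
    using TN(1) by (auto simp: transversal_def)
  obtain X Y where XY: "X \<subseteq> ground T" "N = delete (contract T X) Y"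
    using TN(2) by (auto simp: minor_of_def)
  obtain f where f: "bij_betw f (ground M) (ground N)"
    "\<And>Z. Z \<subseteq> ground M \<Longrightarrow> indep M Z \<longleftrightarrow> indep N (f ` Z)"
    using TN(3) by (auto simp: isomorphic_def)
  \<comment> \<open>A basis of \<open>X\<close> determines the contraction, so only \<open>B\<close>
    is kept as the contracted set.\<close>
  obtain B where B: "B \<subseteq> X" "indep T B" "card B = rk T X"
    using rk_witness [of X T] by blast
  \<comment> \<open>Takes the new labels back to the ground set of \<open>T\<close>:
    \<open>Inl\<close> labels by the isomorphism, \<open>Inr\<close> labels by undoing
    \<open>c\<close>.\<close>
  define h where "h = case_sum f (inv c)"
  have "indep M Z \<longleftrightarrow>
      partial_transversal n (\<lambda>j. h -` A j) (Inl ` Z \<union> Inr ` c ` B :: ('a + nat) set)"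
    if Z: "Z \<subseteq> ground M" for Z
  proof -
    let ?W = "Inl ` Z \<union> Inr ` c ` B :: ('a + nat) set"
    have fZ: "f ` Z \<subseteq> ground T - X - Y"
      using Z f(1) XY(2) by (auto simp: bij_betw_def)
    have h_im: "h ` Inl ` Z = f ` Z" "h ` Inr ` c ` B = B"
      using assms(2) by (simp_all add: h_def image_image)
    then have im: "h ` ?W = f ` Z \<union> B" by (simp add: image_Un)
    have "inj_on f Z" using inj_on_subset [OF bij_betw_imp_inj_on [OF f(1)] Z] .
    then have "inj_on h (Inl ` Z)" by (simp add: inj_on_def h_def)
    moreover have "inj_on h (Inr ` c ` B)" using assms(2) by (simp add: inj_on_def h_def)
    moreover have "h ` Inl ` Z \<inter> h ` Inr ` c ` B = {}" unfolding h_im using fZ B(1) by blast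
    ultimately have inj: "inj_on h ?W" unfolding inj_on_Un by blast
    have "indep M Z \<longleftrightarrow> indep T (f ` Z \<union> B)"
      using f(2) [OF Z] fZ indep_contract [OF XY(1) B, of "f ` Z"]
      by (auto simp: XY(2) indep_delete)
    also have "\<dots> \<longleftrightarrow> partial_transversal n (\<lambda>j. h -` A j) ?W"
      using partial_transversal_vimage [OF inj, of n A] A by (simp only: im)
    finally show ?thesis .
  qed
  then show ?thesis
    using indep_finite [OF B(2)] by (intro that [of "c ` B" n "\<lambda>j. h -` A j"]) auto
qed

text \<open>The elements of \<open>X\<close> are to be contracted. An injection of all elements into
  \<open>nat\<close> yields the transversal matroid over \<open>nat\<close> that
  \<open>gammoid\<close> asks for.\<close>

lemma gammoidI:
  fixes M :: "'a matroid" and f :: "'a \<Rightarrow> 'b"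
  assumes "inj_on f (ground M)" "finite X" "f ` ground M \<inter> X = {}"
    and "\<And>Z. Z \<subseteq> ground M \<Longrightarrow> indep M Z \<longleftrightarrow> partial_transversal n A (f ` Z \<union> X)"
  shows "gammoid M"
proof -
  define D where "D = f ` ground M \<union> X"
  have "finite D" using assms(2) by (simp add: D_def)
  then obtain h :: "'b \<Rightarrow> nat" where h: "inj_on h D"
    using finite_imp_inj_to_nat_seg by blast
  define A' where "A' j = h ` (A j \<inter> D)" for j
  have A': "partial_transversal n A' (h ` V) \<longleftrightarrow> partial_transversal n A V" if "V \<subseteq> D" for V
  proof -
    have "partial_transversal n A' (h ` V) \<longleftrightarrow> partial_transversal n (\<lambda>j. h -` A' j) V"
      using partial_transversal_vimage [OF inj_on_subset [OF h that]] by blast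
    also have "\<dots> \<longleftrightarrow> partial_transversal n A V"
      using that h by (intro partial_transversal_cong) (auto simp: A'_def inj_on_def)
    finally show ?thesis .
  qed
  obtain T where T: "ground T = h ` D"
    "\<And>W. indep T W \<longleftrightarrow> W \<subseteq> h ` D \<and> partial_transversal n A' W"
    using transversal_matroid_exists [of "h ` D" n A'] \<open>finite D\<close> by auto
  have "transversal T" using T by (intro transversalI [of T n A']) auto
  have hX: "h ` X \<subseteq> ground T" by (auto simp: T D_def)
  \<comment> \<open>The case \<open>Z = {}\<close> makes the contracted set independent, hence its
    own basis in \<open>indep_contract\<close>.\<close>
  have "partial_transversal n A X" using assms(4) [of "{}"] by simp
  then have "indep T (h ` X)" using A' [of X] hX by (simp add: T D_def)
  then have con: "indep (contract T (h ` X)) Z \<longleftrightarrow> Z \<subseteq> ground T - h ` X \<and> indep T (Z \<union> h ` X)" for Z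
    using indep_contract [OF hX order_refl] rk_indep by metis
  define N where "N = delete (contract T (h ` X)) {}"
  have gN: "ground N = (h \<circ> f) ` ground M"
    using h assms(3) by (auto simp: N_def T D_def inj_on_def)
  have "indep M Z \<longleftrightarrow> indep N ((h \<circ> f) ` Z)" if Z: "Z \<subseteq> ground M" for Z
  proof -
    have sub: "(h \<circ> f) ` Z \<subseteq> ground N" using Z gN by auto
    then have "indep N ((h \<circ> f) ` Z) \<longleftrightarrow> indep T ((h \<circ> f) ` Z \<union> h ` X)"
      by (auto simp: N_def indep_delete con)
    also have "(h \<circ> f) ` Z \<union> h ` X = h ` (f ` Z \<union> X)" by (auto simp: image_Un)
    also have "indep T \<dots> \<longleftrightarrow> partial_transversal n A (f ` Z \<union> X)"
    proof -
      have "f ` Z \<union> X \<subseteq> D" using Z by (auto simp: D_def)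
      then show ?thesis using A' [of "f ` Z \<union> X"] T(2) by (simp add: image_mono)
    qed
    also have "\<dots> \<longleftrightarrow> indep M Z" using assms(4) [OF Z] by simp
    finally show ?thesis ..
  qed
  moreover have "inj_on (h \<circ> f) (ground M)"
    using assms(1) h by (intro comp_inj_on) (auto simp: D_def intro: inj_on_subset)
  ultimately have "isomorphic M N"
    unfolding isomorphic_def using gN by (intro exI [of _ "h \<circ> f"]) (simp add: bij_betw_def)
  moreover have "minor_of N T"
    unfolding minor_of_def N_def using hX by (intro exI [of _ "h ` X"] exI [of _ "{}"]) simp
  ultimately show ?thesis using \<open>transversal T\<close> unfolding gammoid_def by blast
qed

text \<open>Writes \<open>N\<close> as the contraction of a transversal matroid \<open>T\<close> by
  an independent set, with no further elements to delete; the rank equation for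
  \<open>Y = {}\<close> gives that independence.\<close>

lemma gammoid_lift:
  fixes N :: "'a matroid" and c :: "nat \<Rightarrow> nat"
  assumes "gammoid N" "inj c"
  obtains T :: "('a + nat) matroid" and X where "transversal T" "finite X" "X \<subseteq> range c"
    "ground T = Inl ` ground N \<union> Inr ` X"
    "\<forall>Y\<subseteq>ground N. rk T (Inl ` Y \<union> Inr ` X) = rk N Y + card X"
proof -
  obtain n A X where X: "finite X" "X \<subseteq> range c"
    "\<forall>Z\<subseteq>ground N.
      indep N Z \<longleftrightarrow> partial_transversal n A (Inl ` Z \<union> Inr ` X :: ('a + nat) set)"
    by (rule gammoidE [OF assms]) (rule that)
  let ?G = "Inl ` ground N \<union> Inr ` X :: ('a + nat) set"
  obtain T where T: "ground T = ?G" "\<And>W. indep T W \<longleftrightarrow> W \<subseteq> ?G \<and> partial_transversal n A W"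
    using transversal_matroid_exists [of ?G n A] X(1) by auto
  have ind: "indep T (Inl ` Z \<union> Inr ` X) \<longleftrightarrow> indep N Z" if "Z \<subseteq> ground N" for Z
    using that X(3) T(2) [of "Inl ` Z \<union> Inr ` X"] by auto
  have cd: "card (Inl ` Z \<union> Inr ` X :: ('a + nat) set) = card Z + card X" if "finite Z" for Z :: "'a set"
    using that X(1) by (subst card_Un_disjoint) (auto simp: card_image)
  have "rk T (Inl ` Y \<union> Inr ` X) = rk N Y + card X" if Y: "Y \<subseteq> ground N" for Y
  proof (rule antisym)
    have "indep T (Inr ` X)" using ind [of "{}"] by simp
    then obtain J where J: "Inr ` X \<subseteq> J" "J \<subseteq> Inl ` Y \<union> Inr ` X" "indep T J"
      "card J = rk T (Inl ` Y \<union> Inr ` X)"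
      using indep_extend [of T "Inr ` X" "Inl ` Y \<union> Inr ` X"] by blast
    define I where "I = {y \<in> Y. Inl y \<in> J}"
    have IY: "I \<subseteq> Y" by (auto simp: I_def)
    have J_eq: "J = Inl ` I \<union> Inr ` X" using J(1,2) by (auto simp: I_def)
    then have indI: "indep N I" using J(3) ind [of I] IY Y by auto
    then show "rk T (Inl ` Y \<union> Inr ` X) \<le> rk N Y + card X"
      using card_le_rk [OF indI IY] cd [OF indep_finite [OF indI]] J(4) J_eq by simp
  next
    obtain I where I: "I \<subseteq> Y" "indep N I" "card I = rk N Y"
      using rk_witness [of Y N] by blast
    then have "indep T (Inl ` I \<union> Inr ` X)" using ind [of I] Y by auto
    then have "card (Inl ` I \<union> Inr ` X :: ('a + nat) set) \<le> rk T (Inl ` Y \<union> Inr ` X)"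
      using I(1) by (intro card_le_rk) auto
    then show "rk N Y + card X \<le> rk T (Inl ` Y \<union> Inr ` X)"
      using cd [OF indep_finite [OF I(2)]] I(3) by simp
  qed
  moreover have "transversal T" using T by (intro transversalI [of T n A]) auto
  ultimately show ?thesis using X(1,2) T(1) by (intro that) auto
qed

section \<open>The independent sets of the construction\<close>

text \<open>The conditions on the parameters for a natural number \<open>k\<close>, with all
  differences moved across so that subtraction never truncates.\<close>

locale mk_parameters =
  fixes N1 :: "'a matroid" and A1 U1 :: "'a set"
    and N2 :: "'a matroid" and A2 U2 :: "'a set" and k :: nat
  assumes finite_U: "finite U1" "finite U2"
    and disjoint: "ground N1 \<inter> ground N2 = {}" "U1 \<inter> U2 = {}"
      "U1 \<inter> (ground N1 \<union> ground N2) = {}" "U2 \<inter> (ground N1 \<union> ground N2) = {}"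
    and subset: "A1 \<subseteq> ground N1" "A2 \<subseteq> ground N2"
    and card_U: "card U1 + matroid_rank N1 + card A2 = k" "card U2 + matroid_rank N2 + card A1 = k"
    and k_ge: "matroid_rank N1 + nullity N1 A1 + matroid_rank N2 + nullity N2 A2 \<le> k"
begin

abbreviation R1 where "R1 \<equiv> ground N1"
abbreviation R2 where "R2 \<equiv> ground N2"
abbreviation V1 where "V1 \<equiv> U1 \<union> A2"
abbreviation V2 where "V2 \<equiv> U2 \<union> A1"
abbreviation r1 where "r1 \<equiv> matroid_rank N1"
abbreviation r2 where "r2 \<equiv> matroid_rank N2"
abbreviation E where "E \<equiv> R1 \<union> R2 \<union> U1 \<union> U2"

text \<open>Since \<open>card V1 + r1 = k\<close>, the first long inequality bounds the nullity of
  \<open>X \<inter> R1\<close> by \<open>card (V1 - X)\<close>; likewise for the second. No matroid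
  \<open>M\<close> enters, so the predicate can be presented by sets before any matroid is at
  hand.\<close>

definition mk_indep :: "'a set \<Rightarrow> bool" where
  "mk_indep X \<longleftrightarrow> X \<subseteq> E \<and> card X \<le> k \<and>
     card (X \<inter> R1) + card (X \<inter> V1) + r1 \<le> k + rk N1 (X \<inter> R1) \<and>
     card (X \<inter> R2) + card (X \<inter> V2) + r2 \<le> k + rk N2 (X \<inter> R2)"

lemma swap: "mk_parameters N2 A2 U2 N1 A1 U1 k"
  by unfold_locales (use finite_U disjoint subset card_U k_ge in auto)

lemma finite_E: "finite E"
  using finite_U by simp

lemma finite_A: "finite A1" "finite A2"
  using finite_subset [OF subset(1)] finite_subset [OF subset(2)] by auto

lemma V_disjoint: "R1 \<inter> V1 = {}" "R2 \<inter> V2 = {}" "V1 \<inter> V2 = {}" "V1 \<subseteq> E" "V2 \<subseteq> E"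
  using disjoint subset by auto

lemma finite_V: "finite V1" "finite V2"
  using finite_U finite_A by auto

lemma card_V: "card V1 + r1 = k" "card V2 + r2 = k"
proof -
  have "card V1 = card U1 + card A2" "card V2 = card U2 + card A1"
    using finite_U finite_A disjoint subset by (auto intro!: card_Un_disjoint)
  then show "card V1 + r1 = k" "card V2 + r2 = k" using card_U by auto
qed

lemma rank_le_k: "r1 + r2 \<le> k"
  using k_ge by simp

text \<open>This makes the constraint of \<open>N2\<close> in \<open>mk_indep\<close> void for subsets of \<open>R1 \<union> V1\<close>.\<close>
lemma A_bound:
  assumes "X \<subseteq> A1" "Y \<subseteq> A2"
  shows "card X + card Y + r1 + r2 \<le> k + rk N1 X + rk N2 Y"
  using nullity_subset_le [OF assms(1) finite_A(1), of N1]
    nullity_subset_le [OF assms(2) finite_A(2), of N2] k_ge by simp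

text \<open>By \<open>A_bound\<close> only the constraint of \<open>N1\<close> remains; the bound by
  \<open>k\<close> follows from it because \<open>rk N1 X \<le> r1\<close> and
  \<open>card V1 + r1 = k\<close>.\<close>

lemma mk_indep_Un_V1:
  assumes "X \<subseteq> R1" "V \<subseteq> V1"
  shows "mk_indep (X \<union> V) \<longleftrightarrow> card X + card V \<le> card V1 + rk N1 X"
proof -
  have fin: "finite X" "finite V"
    using finite_subset [OF assms(1)] finite_subset [OF assms(2)] finite_V by auto
  have eqs: "(X \<union> V) \<inter> R1 = X" "(X \<union> V) \<inter> V1 = V" "(X \<union> V) \<inter> R2 = V \<inter> A2"
    "(X \<union> V) \<inter> V2 = X \<inter> A1" "X \<subseteq> E" "V \<subseteq> E"
    using assms disjoint subset by blast+
  have c: "card (X \<union> V) = card X + card V"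
    using fin assms V_disjoint(1) by (intro card_Un_disjoint) blast+
  have "rk N1 (X \<inter> A1) \<le> r1" using subset(1) by (intro rk_le_matroid_rank) auto
  then have "card (V \<inter> A2) + card (X \<inter> A1) + r2 \<le> k + rk N2 (V \<inter> A2)"
    using A_bound [of "X \<inter> A1" "V \<inter> A2"] by simp
  moreover have "rk N1 X \<le> r1" using assms(1) by (rule rk_le_matroid_rank)
  ultimately show ?thesis using card_V(1) by (auto simp: mk_indep_def eqs c)
qed

text \<open>With all of \<open>V1\<close> used up, the admissible nullity of \<open>X\<close> is
  zero. This exhibits \<open>N1\<close> as a contraction by \<open>V1\<close> restricted to
  \<open>R1\<close>.\<close>

lemma indep1_iff_mk_indep:
  assumes "X \<subseteq> R1"
  shows "indep N1 X \<longleftrightarrow> mk_indep (X \<union> V1)"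
proof -
  have "finite X" using finite_subset [OF assms] by simp
  then show ?thesis
    using mk_indep_Un_V1 [OF assms order_refl] rk_le_card [of X N1]
    by (auto simp: indep_iff_rk)
qed

section \<open>Transversality of the construction\<close>

lemma mk_presentation:
  assumes "transversal N1" "transversal N2"
  shows "\<exists>n C. \<forall>X\<subseteq>E. partial_transversal n C X \<longleftrightarrow> mk_indep X"
proof -
  obtain A where A: "\<And>j. j < r1 \<Longrightarrow> A j \<subseteq> R1" "\<And>X. indep N1 X \<longleftrightarrow> partial_transversal r1 A X"
    using transversal_rank_presentation [OF assms(1)] by auto
  obtain B where B: "\<And>j. j < r2 \<Longrightarrow> B j \<subseteq> R2" "\<And>X. indep N2 X \<longleftrightarrow> partial_transversal r2 B X"
    using transversal_rank_presentation [OF assms(2)] by auto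
  \<comment> \<open>The sets of \<open>N1\<close> come first, those of \<open>N2\<close> are shifted
    by \<open>r1\<close>, and the remaining \<open>k - (r1 + r2)\<close> indices carry
    \<open>E\<close>; \<open>rank_le_k\<close> leaves room for both families.\<close>
  define C where "C j = (if j < r1 then A j \<union> (E - (R1 \<union> V1))
    else if j < r1 + r2 then B (j - r1) \<union> (E - (R2 \<union> V2)) else E)" for j
  have "partial_transversal k C X \<longleftrightarrow> mk_indep X" if X: "X \<subseteq> E" for X
  proof
    have finX: "finite X" using finite_subset [OF X finite_E] .
    assume "partial_transversal k C X"
    then obtain f where f: "inj_on f X" "\<And>x. x \<in> X \<Longrightarrow> f x < k \<and> x \<in> C (f x)"
      by (auto simp: partial_transversal_def)
    \<comment> \<open>At most \<open>k - card J\<close> elements can be matched outside the index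
      set \<open>J\<close>.\<close>
    have count: "card Y \<le> card {x \<in> Y. f x \<in> J} + (k - card J)" if "Y \<subseteq> X" "J \<subseteq> {..<k}" for Y J
    proof -
      have finY: "finite Y" using finite_subset [OF that(1) finX] .
      have "inj_on f {x \<in> Y. f x \<notin> J}" using f(1) by (rule inj_on_subset) (use that in auto)
      moreover have "f ` {x \<in> Y. f x \<notin> J} \<subseteq> {..<k} - J" using that f(2) by auto
      ultimately have "card {x \<in> Y. f x \<notin> J} \<le> card ({..<k} - J)"
        by (rule card_inj_on_le) simp
      also have "\<dots> = k - card J"
        using that(2) finite_subset [OF that(2)] by (simp add: card_Diff_subset)
      finally have "card {x \<in> Y. f x \<notin> J} \<le> k - card J" .
      moreover have "card Y = card {x \<in> Y. f x \<in> J} + card (Y - {x \<in> Y. f x \<in> J})"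
        using finY by (intro card_eq_add_Diff) auto
      moreover have "Y - {x \<in> Y. f x \<in> J} = {x \<in> Y. f x \<notin> J}" by auto
      ultimately show ?thesis by simp
    qed
    have "card X \<le> card (f ` X)" using f(1) by (simp add: card_image)
    also have "\<dots> \<le> card {..<k}" using f(2) by (intro card_mono) auto
    finally have "card X \<le> k" by simp
    moreover have "card (X \<inter> R1) + card (X \<inter> V1) + r1 \<le> k + rk N1 (X \<inter> R1)"
    proof -
      let ?Y = "X \<inter> R1 \<union> X \<inter> V1"
      \<comment> \<open>The first \<open>r1\<close> sets contain no element of \<open>V1\<close>, so
        the elements of \<open>?Y\<close> matched to them form an independent subset of
        \<open>X \<inter> R1\<close>.\<close>
      let ?I = "{x \<in> ?Y. f x \<in> {..<r1}}"
      have I: "x \<in> A (f x) \<and> x \<in> R1" if "x \<in> ?I" for x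
        using that f(2) [of x] A(1) [of "f x"] by (auto simp: C_def)
      have "partial_transversal r1 A ?I"
        unfolding partial_transversal_def
        using I f(1) by (intro exI [of _ f]) (auto intro: inj_on_subset)
      then have "indep N1 ?I" using A(2) by blast
      moreover have "?I \<subseteq> X \<inter> R1" using I by blast
      ultimately have "card ?I \<le> rk N1 (X \<inter> R1)" by (rule card_le_rk)
      moreover have "card ?Y \<le> card ?I + (k - r1)"
        using count [of ?Y "{..<r1}"] rank_le_k by auto
      moreover have "card ?Y = card (X \<inter> R1) + card (X \<inter> V1)"
        using finX V_disjoint by (intro card_Un_disjoint) auto
      ultimately show ?thesis using rank_le_k by linarith
    qed
    moreover have "card (X \<inter> R2) + card (X \<inter> V2) + r2 \<le> k + rk N2 (X \<inter> R2)"
    proof -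
      let ?Y = "X \<inter> R2 \<union> X \<inter> V2"
      let ?I = "{x \<in> ?Y. f x \<in> {r1..<r1+r2}}"
      have I: "f x - r1 < r2 \<and> x \<in> B (f x - r1) \<and> x \<in> R2" if "x \<in> ?I" for x
      proof -
        have lt: "f x - r1 < r2" using that by auto
        then have "B (f x - r1) \<subseteq> R2" by (rule B(1))
        then show ?thesis using lt that f(2) [of x] by (auto simp: C_def)
      qed
      have "inj_on (\<lambda>x. f x - r1) ?I"
      proof (rule inj_onI)
        fix x y assume "x \<in> ?I" "y \<in> ?I" "f x - r1 = f y - r1"
        then have "f x = f y" "x \<in> X" "y \<in> X" by auto
        then show "x = y" by (rule inj_onD [OF f(1)])
      qed
      moreover have "\<forall>x\<in>?I. f x - r1 < r2 \<and> x \<in> B (f x - r1)" using I by blast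
      ultimately have "partial_transversal r2 B ?I"
        unfolding partial_transversal_def by (intro exI [of _ "\<lambda>x. f x - r1"] conjI)
      then have "indep N2 ?I" using B(2) by blast
      moreover have "?I \<subseteq> X \<inter> R2" using I by blast
      ultimately have "card ?I \<le> rk N2 (X \<inter> R2)" by (rule card_le_rk)
      moreover have "card ?Y \<le> card ?I + (k - r2)"
      proof -
        have "{r1..<r1+r2} \<subseteq> {..<k}" using rank_le_k by auto
        then show ?thesis using count [of ?Y "{r1..<r1+r2}"] by simp
      qed
      moreover have "card ?Y = card (X \<inter> R2) + card (X \<inter> V2)"
        using finX V_disjoint by (intro card_Un_disjoint) auto
      ultimately show ?thesis using rank_le_k by linarith
    qed
    ultimately show "mk_indep X" using X by (simp add: mk_indep_def)
  next
    have finX: "finite X" using finite_subset [OF X finite_E] .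
    assume "mk_indep X"
    then have m: "card X \<le> k"
      "card (X \<inter> R1) + card (X \<inter> V1) + r1 \<le> k + rk N1 (X \<inter> R1)"
      "card (X \<inter> R2) + card (X \<inter> V2) + r2 \<le> k + rk N2 (X \<inter> R2)"
      by (auto simp: mk_indep_def)
    have "card Y \<le> card (meeting k C Y)" if Y: "Y \<subseteq> X" for Y
    proof (cases "Y = {}")
      case False
      have finY: "finite Y" using finite_subset [OF Y finX] .
      \<comment> \<open>A lower estimate for the indices below \<open>r1\<close> whose sets meet
        \<open>Y\<close>: once \<open>Y\<close> leaves \<open>R1 \<union> V1\<close>, all of them
        do. \<open>J2\<close> is the analogue for \<open>N2\<close>, before the shift.\<close>
      define J1 where "J1 = (if Y \<subseteq> R1 \<union> V1 then meeting r1 A (Y \<inter> R1) else {..<r1})"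
      define J2 where "J2 = (if Y \<subseteq> R2 \<union> V2 then meeting r2 B (Y \<inter> R2) else {..<r2})"
      have J: "J1 \<subseteq> {..<r1}" "J2 \<subseteq> {..<r2}" by (auto simp: J1_def J2_def meeting_def)
      have finJ: "finite J1" "finite J2" using J finite_subset by auto
      have "J1 \<subseteq> meeting k C Y"
        using Y X rank_le_k by (auto simp: J1_def meeting_def C_def)
      moreover have "(+) r1 ` J2 \<subseteq> meeting k C Y"
        using Y X rank_le_k by (auto simp: J2_def meeting_def C_def)
      moreover have "{r1 + r2..<k} \<subseteq> meeting k C Y"
        using Y X False by (auto simp: meeting_def C_def)
      ultimately have "card (J1 \<union> (+) r1 ` J2 \<union> {r1 + r2..<k}) \<le> card (meeting k C Y)"
        by (intro card_mono) auto
      moreover have "card (J1 \<union> (+) r1 ` J2 \<union> {r1 + r2..<k}) =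
          card (J1 \<union> (+) r1 ` J2) + card {r1 + r2..<k}"
        using J finJ by (intro card_Un_disjoint) auto
      moreover have "card (J1 \<union> (+) r1 ` J2) = card J1 + card ((+) r1 ` J2)"
        using J finJ by (intro card_Un_disjoint) auto
      moreover have "card ((+) r1 ` J2) = card J2" by (intro card_image) auto
      ultimately have c: "card J1 + card J2 + (k - (r1 + r2)) \<le> card (meeting k C Y)" by simp
      have J1: "rk N1 (Y \<inter> R1) \<le> card J1"
        using rk_le_card_meeting [OF A(2), of "Y \<inter> R1"] rk_le_matroid_rank [of "Y \<inter> R1" N1]
        by (auto simp: J1_def)
      have J2: "rk N2 (Y \<inter> R2) \<le> card J2"
        using rk_le_card_meeting [OF B(2), of "Y \<inter> R2"] rk_le_matroid_rank [of "Y \<inter> R2" N2]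
        by (auto simp: J2_def)
      show ?thesis
      proof (cases "Y \<subseteq> R1 \<union> V1")
        case Y1: True
        have Y1c: "card Y = card (Y \<inter> R1) + card (Y \<inter> V1)"
          using Y1 V_disjoint finY
          by (subst card_Un_disjoint [symmetric]) (auto intro: arg_cong [where f = card])
        show ?thesis
        proof (cases "Y \<subseteq> R2 \<union> V2")
          case Y2: True
          \<comment> \<open>Here \<open>Y\<close> lies in \<open>A1 \<union> A2\<close>, and the
            lower bound on \<open>k\<close> alone gives Hall's condition through
            \<open>A_bound\<close>.\<close>
          have Y12: "Y \<inter> R1 \<subseteq> A1" "Y \<inter> R2 \<subseteq> A2" "Y \<inter> V1 = Y \<inter> R2"
            using Y1 Y2 V_disjoint disjoint subset by auto
          then show ?thesis
            using A_bound [OF Y12(1,2)] Y1c J1 J2 c rank_le_k by simp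
        next
          case Y2: False
          \<comment> \<open>All sets of the second family meet \<open>Y\<close>, so the constraint
            of \<open>N1\<close>, passed from \<open>X\<close> to \<open>Y\<close> by monotone
            nullity, is enough.\<close>
          then have "card J2 = r2" by (simp add: J2_def)
          moreover have "card (Y \<inter> R1) + rk N1 (X \<inter> R1) \<le> card (X \<inter> R1) + rk N1 (Y \<inter> R1)"
            using Y finX by (intro nullity_mono) auto
          moreover have "card (Y \<inter> V1) \<le> card (X \<inter> V1)"
            using Y finX by (intro card_mono) auto
          ultimately show ?thesis using m(2) Y1c J1 c rank_le_k by linarith
        qed
      next
        case Y1: False
        then have J1r: "card J1 = r1" by (simp add: J1_def)
        show ?thesis
        proof (cases "Y \<subseteq> R2 \<union> V2")
          case Y2: True
          have Y2c: "card Y = card (Y \<inter> R2) + card (Y \<inter> V2)"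
            using Y2 V_disjoint finY
            by (subst card_Un_disjoint [symmetric]) (auto intro: arg_cong [where f = card])
          moreover have "card (Y \<inter> R2) + rk N2 (X \<inter> R2) \<le> card (X \<inter> R2) + rk N2 (Y \<inter> R2)"
            using Y finX by (intro nullity_mono) auto
          moreover have "card (Y \<inter> V2) \<le> card (X \<inter> V2)"
            using Y finX by (intro card_mono) auto
          ultimately show ?thesis using m(3) J2 J1r c rank_le_k by linarith
        next
          case Y2: False
          then have "card J2 = r2" by (simp add: J2_def)
          moreover have "card Y \<le> card X" using Y finX by (rule card_mono [rotated])
          ultimately show ?thesis using m(1) J1r c rank_le_k by linarith
        qed
      qed
    qed simp
    then show "partial_transversal k C X"
      using partial_transversal_iff_card_meeting [OF finX] by blast
  qed
  then show ?thesis by blast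
qed

text \<open>Every circuit \<open>D\<close> of \<open>N1\<close> yields the circuit \<open>D \<union> V1\<close> of the construction, which meets all sets
  that meet \<open>V1\<close>. So these sets may be enlarged to contain \<open>R1\<close>, and any \<open>card V1\<close> of them may be
  used up by the contraction of \<open>V1\<close>.\<close>
lemma transversal1_if_mk_presentation:
  assumes C: "\<And>X. X \<subseteq> E \<Longrightarrow> partial_transversal n C X \<longleftrightarrow> mk_indep X"
  shows "transversal N1"
proof -
  define N where "N = meeting n C V1"
  have finN: "finite N" by (simp add: N_def)
  have "mk_indep ({} \<union> V1)" using mk_indep_Un_V1 [of "{}" V1] by simp
  then have "partial_transversal n C V1" using C [of V1] V_disjoint by simp
  then have "card V1 \<le> card N"
    unfolding N_def by (rule partial_transversal_card_meeting)
  then obtain J where J: "J \<subseteq> N" "card J = card V1"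
    by (rule obtain_subset_with_card_n) (rule that)
  \<comment> \<open>Indices in \<open>J\<close> are reserved for \<open>V1\<close>; the other sets
    meeting \<open>V1\<close> grow to \<open>R1\<close>.\<close>
  define C' where "C' j = (if j \<in> J then {} else if j \<in> N then R1 else C j \<inter> R1)" for j
  have "indep N1 X \<longleftrightarrow> partial_transversal n C' X" if X: "X \<subseteq> R1" for X
  proof
    assume "indep N1 X"
    then have "mk_indep (X \<union> V1)" using indep1_iff_mk_indep [OF X] by simp
    then have "partial_transversal n C (X \<union> V1)" using C [of "X \<union> V1"] X V_disjoint by blast
    then obtain f where f: "inj_on f (X \<union> V1)" "\<And>x. x \<in> X \<union> V1 \<Longrightarrow> f x < n \<and> x \<in> C (f x)"
      by (auto simp: partial_transversal_def)
    have fV: "f ` V1 \<subseteq> N" using f(2) by (fastforce simp: N_def meeting_def)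
    have "card (f ` V1) = card V1"
      using f(1) by (intro card_image) (rule inj_on_subset, auto)
    then have "card (N - f ` V1) = card (N - J)"
      using fV J finN finite_V(1) finite_subset [OF J(1)] by (simp add: card_Diff_subset)
    \<comment> \<open>\<open>V1\<close> occupies as many indices of \<open>N\<close> as
      \<open>J\<close> contains, so \<open>t\<close> moves the other indices of \<open>N\<close> off
      \<open>J\<close>. The set of \<open>C'\<close> at each new index is all of \<open>R1\<close>,
      so any such bijection will do.\<close>
    then obtain t where t: "bij_betw t (N - f ` V1) (N - J)"
      using finite_same_card_bij finN by blast
    then have t_mem: "t i \<in> N - J" if "i \<in> N - f ` V1" for i
      using that bij_betwE by blast
    have fX: "f x \<notin> f ` V1" if "x \<in> X" for x
      using that f(1) X V_disjoint(1) by (auto simp: inj_on_def)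
    define f' where "f' x = (if f x \<in> N then t (f x) else f x)" for x
    have "inj_on f' X"
    proof (rule inj_onI)
      fix x y assume xy: "x \<in> X" "y \<in> X" "f' x = f' y"
      have "f x \<in> N \<longleftrightarrow> f y \<in> N"
        using xy t_mem [of "f x"] t_mem [of "f y"] fX by (auto simp: f'_def split: if_splits)
      then have "f x = f y"
        using xy fX inj_onD [OF bij_betw_imp_inj_on [OF t], of "f x" "f y"]
        by (auto simp: f'_def split: if_splits)
      then show "x = y" using xy f(1) by (auto simp: inj_on_def)
    qed
    moreover have "f' x < n \<and> x \<in> C' (f' x)" if "x \<in> X" for x
    proof (cases "f x \<in> N")
      case True
      then have "t (f x) \<in> N - J" using t_mem fX that by blast
      then show ?thesis using True that X by (auto simp: f'_def C'_def N_def meeting_def)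
    next
      case False
      then show ?thesis using that f(2) X J(1) by (auto simp: f'_def C'_def)
    qed
    ultimately show "partial_transversal n C' X" unfolding partial_transversal_def by blast
  next
    assume X': "partial_transversal n C' X"
    show "indep N1 X"
    proof (rule ccontr)
      assume "\<not> indep N1 X"
      then obtain D where D: "D \<subseteq> X" "circuit N1 D"
        using dependent_contains_circuit [OF X] by blast
      have finD: "finite D" using finite_subset [of D R1] D X by auto
      have D_indep: "indep N1 Y" if "Y \<subset> D" for Y using D(2) that by (simp add: circuit_def)
      have rD: "rk N1 D < card D"
        using D(2) rk_le_card [OF finD, of N1] indep_iff_rk [OF finD, of N1]
        by (auto simp: circuit_def)
      then have "D \<noteq> {}" by auto
      then obtain d where d: "d \<in> D" by blast
      have rD': "card D \<le> Suc (rk N1 D)"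
      proof -
        have "rk N1 (D - {d}) = card (D - {d})" using d by (intro rk_indep D_indep) auto
        then show ?thesis using rk_mono [of "D - {d}" D N1] d finD by simp
      qed
      have DV: "D \<union> V1 \<subseteq> E" using D X V_disjoint by auto
      have "\<not> mk_indep (D \<union> V1)"
        using mk_indep_Un_V1 [of D V1] D X rD by auto
      then have "\<not> partial_transversal n C (D \<union> V1)" using C [OF DV] by simp
      then obtain Y where Y: "Y \<subseteq> D \<union> V1" "card (meeting n C Y) < card Y"
        using partial_transversal_iff_card_meeting [of "D \<union> V1" n C] finD finite_V
        by (auto simp: not_le)
      \<comment> \<open>A proper subset either loses an element of the circuit \<open>D\<close>, and
        with it all nullity, or loses an element of \<open>V1\<close>, which pays for the nullity
        one of \<open>D\<close>. So only the whole set can violate Hall's condition.\<close>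
      have "Y = D \<union> V1"
      proof (rule ccontr)
        assume neq: "Y \<noteq> D \<union> V1"
        have Y_eq: "Y = (Y \<inter> D) \<union> (Y \<inter> V1)" using Y by auto
        have "card (Y \<inter> D) + card (Y \<inter> V1) \<le> card V1 + rk N1 (Y \<inter> D)"
        proof (cases "Y \<inter> D = D")
          case False
          then have "rk N1 (Y \<inter> D) = card (Y \<inter> D)" by (intro rk_indep D_indep) auto
          moreover have "card (Y \<inter> V1) \<le> card V1" using finite_V by (intro card_mono) auto
          ultimately show ?thesis by simp
        next
          case True
          then have "Y \<inter> V1 \<subset> V1" using Y neq by auto
          then have "card (Y \<inter> V1) < card V1" using finite_V by (intro psubset_card_mono)
          then show ?thesis using True rD' by simp
        qed
        then have "mk_indep ((Y \<inter> D) \<union> (Y \<inter> V1))"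
          using mk_indep_Un_V1 [of "Y \<inter> D" "Y \<inter> V1"] D X by auto
        then have "mk_indep Y" using Y_eq by simp
        moreover have "Y \<subseteq> E" using Y(1) DV by (rule order_trans)
        ultimately have "partial_transversal n C Y" using C [of Y] by simp
        with Y(2) partial_transversal_card_meeting show False by (metis not_le)
      qed
      moreover have "card (D \<union> V1) = card D + card V1"
        using finD finite_V D X V_disjoint by (intro card_Un_disjoint) auto
      ultimately have lt: "card (meeting n C (D \<union> V1)) < card D + card V1" using Y(2) by simp
      obtain g where g: "inj_on g X" "\<And>x. x \<in> X \<Longrightarrow> g x < n \<and> x \<in> C' (g x)"
        using X' by (auto simp: partial_transversal_def)
      have NM: "N \<subseteq> meeting n C (D \<union> V1)" unfolding N_def by (rule meeting_mono) auto
      \<comment> \<open>The matching avoids \<open>J\<close>, and \<open>J\<close> lies in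
        \<open>N\<close>, hence among the indices meeting \<open>D \<union> V1\<close>. By
        \<open>lt\<close>, fewer than \<open>card D\<close> of those remain.\<close>
      have "g ` D \<subseteq> meeting n C (D \<union> V1) - J"
      proof
        fix i assume "i \<in> g ` D"
        then obtain x where x: "x \<in> D" "i = g x" by blast
        then have i: "i < n" "x \<in> C' i" using g(2) D by auto
        then have "i \<notin> J" by (auto simp: C'_def)
        moreover have "i \<in> meeting n C (D \<union> V1)"
          using i x NM \<open>i \<notin> J\<close> by (auto simp: C'_def meeting_def split: if_splits)
        ultimately show "i \<in> meeting n C (D \<union> V1) - J" by simp
      qed
      moreover have "inj_on g D" using g(1) D(1) by (rule inj_on_subset)
      ultimately have "card D \<le> card (meeting n C (D \<union> V1) - J)"
        by (intro card_inj_on_le) auto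
      moreover have "card (meeting n C (D \<union> V1)) = card J + card (meeting n C (D \<union> V1) - J)"
        using J(1) NM by (intro card_eq_add_Diff) auto
      ultimately show False using lt J(2) by simp
    qed
  qed
  then show ?thesis by (rule transversalI)
qed

text \<open>The bounds imposed by the cyclic flats over one of the two matroids amount to a single
  nullity inequality; the flat \<open>E\<close> contributes \<open>card X \<le> k\<close>.\<close>

lemma indep_iff_mk_indep:
  assumes "is_Mk (int k) N1 A1 U1 N2 A2 U2 M" "X \<subseteq> E"
  shows "indep M X \<longleftrightarrow> mk_indep X"
proof -
  have gM: "ground M = E" and rM: "rk M E = k"
    and flats: "{Z. cyclic_flat M Z} = {{}, E} \<union>
      {F \<union> U1 \<union> A2 | F. F \<in> proper_cyclic_flats N1} \<union>
      {F \<union> U2 \<union> A1 | F. F \<in> proper_cyclic_flats N2}"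
    and r1: "\<And>F. F \<in> proper_cyclic_flats N1 \<Longrightarrow> rk M (F \<union> U1 \<union> A2) = rk N1 F + card U1 + card A2"
    and r2: "\<And>F. F \<in> proper_cyclic_flats N2 \<Longrightarrow> rk M (F \<union> U2 \<union> A1) = rk N2 F + card U2 + card A1"
    using assms(1) by (auto simp: is_Mk_def)
  have finX: "finite X" using finite_subset [OF assms(2) finite_E] .
  \<comment> \<open>Forward, the bound is used at a cyclic flat \<open>F\<close> of \<open>N\<close>
    that carries all the nullity of \<open>X \<inter> ground N\<close>. Backward, nullity is
    monotone. The abstract \<open>N\<close> and \<open>V\<close> serve both matroids.\<close>
  have one: "(\<forall>F\<in>proper_cyclic_flats N. card (X \<inter> (F \<union> V)) + matroid_rank N \<le> rk N F + k) \<longleftrightarrow>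
      card (X \<inter> ground N) + card (X \<inter> V) + matroid_rank N \<le> k + rk N (X \<inter> ground N)"
    if "card X \<le> k" "card V + matroid_rank N = k" "finite V" "ground N \<inter> V = {}"
    for N :: "'a matroid" and V
  proof -
    have c: "card (X \<inter> (F \<union> V)) = card (X \<inter> F) + card (X \<inter> V)" if "F \<subseteq> ground N" for F
      using that finX \<open>ground N \<inter> V = {}\<close>
      by (subst card_Un_disjoint [symmetric]) (auto simp: Int_Un_distrib)
    show ?thesis
    proof
      assume flats: "\<forall>F\<in>proper_cyclic_flats N. card (X \<inter> (F \<union> V)) + matroid_rank N \<le> rk N F + k"
      obtain F where F: "cyclic_flat N F" "rk N F + card (X \<inter> ground N - F) \<le> rk N (X \<inter> ground N)"
        using cyclic_flat_max_nullity [of "X \<inter> ground N" N] by auto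
      have FN: "F \<subseteq> ground N" using F(1) by (simp add: cyclic_flat_def flat_def)
      have "card (X \<inter> (F \<union> V)) + matroid_rank N \<le> rk N F + k"
      proof (cases "F \<in> proper_cyclic_flats N")
        case True
        with flats show ?thesis by blast
      next
        case False
        \<comment> \<open>The improper flats are not among the hypotheses: \<open>{}\<close> is
          covered by the size of \<open>V\<close>, and \<open>ground N\<close> by
          \<open>card X \<le> k\<close>.\<close>
        then consider "F = {}" | "F = ground N" using F(1) by (auto simp: proper_cyclic_flats_def)
        then show ?thesis
        proof cases
          case 1
          have "card (X \<inter> V) \<le> card V" using that(3) by (intro card_mono) auto
          then show ?thesis using 1 that(2) by simp
        next
          case 2
          have "card (X \<inter> (F \<union> V)) \<le> card X" using finX by (intro card_mono) auto
          then show ?thesis using 2 that(1) by (simp add: matroid_rank_def)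
        qed
      qed
      moreover have "card (X \<inter> ground N) = card (X \<inter> F) + card (X \<inter> ground N - F)"
      proof -
        have "X \<inter> ground N \<inter> F = X \<inter> F" using FN by auto
        then show ?thesis using card_Int_Diff [of "X \<inter> ground N" F] finX by simp
      qed
      ultimately show "card (X \<inter> ground N) + card (X \<inter> V) + matroid_rank N \<le> k + rk N (X \<inter> ground N)"
        using F(2) c [OF FN] by linarith
    next
      assume *: "card (X \<inter> ground N) + card (X \<inter> V) + matroid_rank N \<le> k + rk N (X \<inter> ground N)"
      show "\<forall>F\<in>proper_cyclic_flats N. card (X \<inter> (F \<union> V)) + matroid_rank N \<le> rk N F + k"
      proof
        fix F assume "F \<in> proper_cyclic_flats N"
        then have FN: "F \<subseteq> ground N"
          by (simp add: proper_cyclic_flats_def cyclic_flat_def flat_def)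
        have "card (X \<inter> F) + rk N (X \<inter> ground N) \<le> card (X \<inter> ground N) + rk N (X \<inter> F)"
          using FN finX by (intro nullity_mono) auto
        moreover have "rk N (X \<inter> F) \<le> rk N F" by (rule rk_mono) auto
        ultimately show "card (X \<inter> (F \<union> V)) + matroid_rank N \<le> rk N F + k"
          using * c [OF FN] by linarith
      qed
    qed
  qed
  have cV: "card V1 = card U1 + card A2" "card V2 = card U2 + card A1"
    using card_V card_U by linarith+
  have "indep M X \<longleftrightarrow> (\<forall>F\<in>{Z. cyclic_flat M Z}. card (X \<inter> F) \<le> rk M F)"
    using indep_iff_cyclic_flats [of X M] assms(2) gM by simp
  also have "\<dots> \<longleftrightarrow> card X \<le> k \<and>
      (\<forall>F\<in>proper_cyclic_flats N1. card (X \<inter> (F \<union> U1 \<union> A2)) \<le> rk M (F \<union> U1 \<union> A2)) \<and>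
      (\<forall>F\<in>proper_cyclic_flats N2. card (X \<inter> (F \<union> U2 \<union> A1)) \<le> rk M (F \<union> U2 \<union> A1))"
    unfolding flats using rM assms(2) by (auto simp: Int_absorb2)
  also have "\<dots> \<longleftrightarrow> card X \<le> k \<and>
      (\<forall>F\<in>proper_cyclic_flats N1. card (X \<inter> (F \<union> V1)) + r1 \<le> rk N1 F + k) \<and>
      (\<forall>F\<in>proper_cyclic_flats N2. card (X \<inter> (F \<union> V2)) + r2 \<le> rk N2 F + k)"
  proof -
    have "card (X \<inter> (F \<union> U1 \<union> A2)) \<le> rk M (F \<union> U1 \<union> A2) \<longleftrightarrow>
        card (X \<inter> (F \<union> V1)) + matroid_rank N1 \<le> rk N1 F + k" if "F \<in> proper_cyclic_flats N1" for F
      using r1 [OF that] card_U(1) by (auto simp: Un_assoc)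
    moreover have "card (X \<inter> (F \<union> U2 \<union> A1)) \<le> rk M (F \<union> U2 \<union> A1) \<longleftrightarrow>
        card (X \<inter> (F \<union> V2)) + matroid_rank N2 \<le> rk N2 F + k" if "F \<in> proper_cyclic_flats N2" for F
      using r2 [OF that] card_U(2) by (auto simp: Un_assoc)
    ultimately show ?thesis by simp
  qed
  also have "\<dots> \<longleftrightarrow> mk_indep X"
    using one [OF _ card_V(1) finite_V(1) V_disjoint(1)] one [OF _ card_V(2) finite_V(2) V_disjoint(2)]
      assms(2) by (auto simp: mk_indep_def)
  finally show ?thesis .
qed

lemma swap_mk_indep: "mk_parameters.mk_indep N2 A2 U2 N1 A1 U1 k X \<longleftrightarrow> mk_indep X"
proof -
  interpret s: mk_parameters N2 A2 U2 N1 A1 U1 k by (rule swap)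
  show ?thesis by (auto simp: mk_indep_def s.mk_indep_def)
qed

lemma transversal_iff:
  assumes "ground M = E" "\<And>X. X \<subseteq> E \<Longrightarrow> indep M X \<longleftrightarrow> mk_indep X"
  shows "transversal N1 \<and> transversal N2 \<longleftrightarrow> transversal M"
proof
  assume "transversal N1 \<and> transversal N2"
  then obtain n C where "\<forall>X\<subseteq>E. partial_transversal n C X \<longleftrightarrow> mk_indep X"
    using mk_presentation by blast
  then show "transversal M" using assms by (intro transversalI [of M n C]) auto
next
  assume "transversal M"
  then obtain n C where C: "\<And>X. indep M X \<longleftrightarrow> partial_transversal n C X"
    by (auto simp: transversal_def)
  interpret s: mk_parameters N2 A2 U2 N1 A1 U1 k by (rule swap)
  have "transversal N1"
    using assms(2) C by (intro transversal1_if_mk_presentation [of n C]) simp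
  moreover have "transversal N2"
  proof (rule s.transversal1_if_mk_presentation)
    fix X assume "X \<subseteq> s.E"
    then have "X \<subseteq> E" by auto
    then show "partial_transversal n C X \<longleftrightarrow> s.mk_indep X"
      using assms(2) C swap_mk_indep by simp
  qed
  ultimately show "transversal N1 \<and> transversal N2" ..
qed

section \<open>Gammoids under the construction\<close>

text \<open>Since \<open>N1\<close> arises by contracting \<open>V1\<close>, the elements of
  \<open>V1\<close> join those already contracted from the transversal matroid behind
  \<open>M\<close>.\<close>

lemma gammoid1:
  assumes "ground M = E" "\<And>X. X \<subseteq> E \<Longrightarrow> indep M X \<longleftrightarrow> mk_indep X" "gammoid M"
  shows "gammoid N1"
proof -
  obtain n A X where X: "finite X" "X \<subseteq> range id"
    "\<forall>Z\<subseteq>ground M.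
      indep M Z \<longleftrightarrow> partial_transversal n A (Inl ` Z \<union> Inr ` X :: ('a + nat) set)"
    by (rule gammoidE [OF assms(3) inj_on_id]) (rule that)
  show ?thesis
  proof (rule gammoidI)
    fix Z assume Z: "Z \<subseteq> R1"
    then have "indep N1 Z \<longleftrightarrow> indep M (Z \<union> V1)"
      using indep1_iff_mk_indep [OF Z] assms(2) [of "Z \<union> V1"] V_disjoint(4) by blast
    also have "\<dots> \<longleftrightarrow> partial_transversal n A (Inl ` (Z \<union> V1) \<union> Inr ` X)"
    proof -
      have "Z \<union> V1 \<subseteq> ground M" using Z V_disjoint(4) unfolding assms(1) by blast
      then show ?thesis by (rule X(3) [rule_format])
    qed
    also have "Inl ` (Z \<union> V1) \<union> Inr ` X = Inl ` Z \<union> (Inl ` V1 \<union> Inr ` X)" by auto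
    finally show "indep N1 Z \<longleftrightarrow> partial_transversal n A (Inl ` Z \<union> (Inl ` V1 \<union> Inr ` X))" .
  qed (use X(1) finite_V(1) V_disjoint(1) in auto)
qed

lemma gammoid_forward:
  assumes M: "ground M = E" "\<And>X. X \<subseteq> E \<Longrightarrow> indep M X \<longleftrightarrow> mk_indep X"
    and "gammoid N1" "gammoid N2"
  shows "gammoid M"
proof -
  \<comment> \<open>Even and odd labels keep the contracted sets \<open>X1\<close> and
    \<open>X2\<close> disjoint.\<close>
  have inj: "inj (\<lambda>n::nat. 2 * n)" "inj (\<lambda>n::nat. 2 * n + 1)"
    by (simp_all add: inj_on_def)
  obtain T1 :: "('a + nat) matroid" and X1 where T1: "transversal T1" "finite X1"
    "X1 \<subseteq> range (\<lambda>n. 2 * n)" "ground T1 = Inl ` R1 \<union> Inr ` X1"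
    "\<forall>Y\<subseteq>R1. rk T1 (Inl ` Y \<union> Inr ` X1) = rk N1 Y + card X1"
    by (rule gammoid_lift [OF assms(3) inj(1)]) (rule that)
  obtain T2 :: "('a + nat) matroid" and X2 where T2: "transversal T2" "finite X2"
    "X2 \<subseteq> range (\<lambda>n. 2 * n + 1)" "ground T2 = Inl ` R2 \<union> Inr ` X2"
    "\<forall>Y\<subseteq>R2. rk T2 (Inl ` Y \<union> Inr ` X2) = rk N2 Y + card X2"
    by (rule gammoid_lift [OF assms(4) inj(2)]) (rule that)
  have X12: "X1 \<inter> X2 = {}"
  proof -
    have "even x" if "x \<in> X1" for x using that T1(3) by auto
    moreover have "odd x" if "x \<in> X2" for x using that T2(3) by auto
    ultimately show ?thesis by blast
  qed
  have cd: "card (Inl ` Z \<union> Inr ` X :: ('a + nat) set) = card Z + card X"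
    if "finite Z" "finite X" for Z :: "'a set" and X :: "nat set"
    using that by (subst card_Un_disjoint) (auto simp: card_image)
  have rT: "matroid_rank T1 = r1 + card X1" "matroid_rank T2 = r2 + card X2"
    using T1(4,5) T2(4,5) by (simp_all add: matroid_rank_def)
  have nT: "nullity T1 (Inl ` A1 \<union> Inr ` X1) = nullity N1 A1"
    "nullity T2 (Inl ` A2 \<union> Inr ` X2) = nullity N2 A2"
    using T1(5) T2(5) subset cd finite_A T1(2) T2(2)
    by (simp_all add: nullity_def)
  \<comment> \<open>Adding \<open>X1\<close> and \<open>X2\<close> to the distinguished sets leaves
    their nullities unchanged, while the ranks rise by \<open>card X1\<close> and
    \<open>card X2\<close>. Raising \<open>k\<close> by both amounts preserves the sizes of
    \<open>U1\<close> and \<open>U2\<close> and the lower bound.\<close>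
  interpret t: mk_parameters T1 "Inl ` A1 \<union> Inr ` X1" "Inl ` U1"
    T2 "Inl ` A2 \<union> Inr ` X2" "Inl ` U2" "k + card X1 + card X2"
  proof
    show "ground T1 \<inter> ground T2 = {}" using T1(4) T2(4) X12 disjoint(1) by auto
    show "Inl ` U1 \<inter> Inl ` U2 = {}" using disjoint(2) by auto
    show "Inl ` U1 \<inter> (ground T1 \<union> ground T2) = {}" "Inl ` U2 \<inter> (ground T1 \<union> ground T2) = {}"
      using T1(4) T2(4) disjoint(3,4) by auto
    show "Inl ` A1 \<union> Inr ` X1 \<subseteq> ground T1" "Inl ` A2 \<union> Inr ` X2 \<subseteq> ground T2"
      using T1(4) T2(4) subset by auto
    show "card (Inl ` U1 :: ('a + nat) set) + matroid_rank T1 + card (Inl ` A2 \<union> Inr ` X2 :: ('a + nat) set)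
        = k + card X1 + card X2"
      "card (Inl ` U2 :: ('a + nat) set) + matroid_rank T2 + card (Inl ` A1 \<union> Inr ` X1 :: ('a + nat) set)
        = k + card X1 + card X2"
      using card_U rT cd finite_A T1(2) T2(2) by (simp_all add: card_image)
    show "matroid_rank T1 + nullity T1 (Inl ` A1 \<union> Inr ` X1) + matroid_rank T2 +
        nullity T2 (Inl ` A2 \<union> Inr ` X2) \<le> k + card X1 + card X2"
      using k_ge rT nT by simp
  qed (use finite_U in auto)
  obtain n C where C: "\<And>X. X \<subseteq> t.E \<Longrightarrow> partial_transversal n C X \<longleftrightarrow> t.mk_indep X"
    using t.mk_presentation [OF T1(1) T2(1)] by blast
  let ?X = "Inr ` (X1 \<union> X2) :: ('a + nat) set"
  have fin12: "finite (X1 \<union> X2)" "card (X1 \<union> X2) = card X1 + card X2"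
    using T1(2) T2(2) X12 by (auto intro: card_Un_disjoint)
  show ?thesis
  proof (rule gammoidI)
    fix Z assume "Z \<subseteq> ground M"
    then have Z: "Z \<subseteq> E" using M(1) by simp
    have finZ: "finite Z" using finite_subset [OF Z finite_E] .
    let ?W = "Inl ` Z \<union> ?X"
    have W: "?W \<subseteq> t.E" using Z T1(4) T2(4) by auto
    have eqs: "?W \<inter> ground T1 = Inl ` (Z \<inter> R1) \<union> Inr ` X1"
      "?W \<inter> (Inl ` U1 \<union> (Inl ` A2 \<union> Inr ` X2)) = Inl ` (Z \<inter> V1) \<union> Inr ` X2"
      "?W \<inter> ground T2 = Inl ` (Z \<inter> R2) \<union> Inr ` X2"
      "?W \<inter> (Inl ` U2 \<union> (Inl ` A1 \<union> Inr ` X1)) = Inl ` (Z \<inter> V2) \<union> Inr ` X1"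
      using T1(4) T2(4) X12 by auto
    \<comment> \<open>Each inequality on the left is the corresponding one on the right with the
      same number added to both sides.\<close>
    have "t.mk_indep ?W \<longleftrightarrow> mk_indep Z"
      unfolding t.mk_indep_def mk_indep_def eqs rT
      using W Z T1(2) T2(2) finZ T1(5) T2(5) fin12
      by (simp add: cd add.assoc)
    then show "indep M Z \<longleftrightarrow> partial_transversal n C ?W"
      using C [OF W] M(2) [OF Z] by simp
  qed (use fin12 in auto)
qed

lemma gammoid_iff:
  assumes M: "ground M = E" "\<And>X. X \<subseteq> E \<Longrightarrow> indep M X \<longleftrightarrow> mk_indep X"
  shows "gammoid N1 \<and> gammoid N2 \<longleftrightarrow> gammoid M"
proof
  assume "gammoid N1 \<and> gammoid N2"
  then show "gammoid M" using gammoid_forward [OF M] by blast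
next
  assume G: "gammoid M"
  interpret s: mk_parameters N2 A2 U2 N1 A1 U1 k by (rule swap)
  have E_eq: "s.E = E" by auto
  have "gammoid N2"
    by (rule s.gammoid1 [of M]) (use M G swap_mk_indep E_eq in auto)
  with gammoid1 [OF M G] show "gammoid N1 \<and> gammoid N2" by blast
qed

section \<open>The dual of the construction\<close>

lemma card_E: "card E = card R1 + card R2 + card U1 + card U2"
  using finite_U disjoint by (subst card_Un_disjoint; auto simp: card_Un_disjoint)+

text \<open>\<open>U1\<close> and \<open>U2\<close> trade places under duality. By
  \<open>nullity_dual\<close> and \<open>card_U\<close>, the lower bound for the dual parameters
  rearranges to \<open>k_ge\<close>.\<close>

lemma dual_parameters: "mk_parameters (dual N1) (R1 - A1) U2 (dual N2) (R2 - A2) U1 (card E - k)"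
proof
  have c: "card R1 = card A1 + card (R1 - A1)" "card R2 = card A2 + card (R2 - A2)"
    by (rule card_eq_add_Diff [OF subset(1)] card_eq_add_Diff [OF subset(2)]; simp)+
  note d = matroid_rank_dual [of N1] matroid_rank_dual [of N2]
  show "card U2 + matroid_rank (dual N1) + card (R2 - A2) = card E - k"
    "card U1 + matroid_rank (dual N2) + card (R1 - A1) = card E - k"
    using c d card_E card_U by linarith+
  have "card A1 = rk N1 A1 + nullity N1 A1" "card A2 = rk N2 A2 + nullity N2 A2"
    by (rule card_eq_rk_nullity [OF finite_A(1)] card_eq_rk_nullity [OF finite_A(2)])+
  then show "matroid_rank (dual N1) + nullity (dual N1) (R1 - A1) + matroid_rank (dual N2) +
      nullity (dual N2) (R2 - A2) \<le> card E - k"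
    using nullity_dual [OF subset(1)] nullity_dual [OF subset(2)] c d card_E card_U k_ge by linarith
qed (use finite_U disjoint in auto)

text \<open>The cyclic flats of the dual are the complements, and \<open>rk_dual\<close> gives their
  ranks.\<close>

lemma is_Mk_dual:
  assumes "is_Mk (int k) N1 A1 U1 N2 A2 U2 M"
  shows "is_Mk (int (card E - k)) (dual N1) (R1 - A1) U2 (dual N2) (R2 - A2) U1 (dual M)"
proof -
  have gM: "ground M = E" and rM: "rk M E = k"
    and flats: "{Z. cyclic_flat M Z} = {{}, E} \<union>
      {F \<union> U1 \<union> A2 | F. F \<in> proper_cyclic_flats N1} \<union>
      {F \<union> U2 \<union> A1 | F. F \<in> proper_cyclic_flats N2}"
    and r1: "\<And>F. F \<in> proper_cyclic_flats N1 \<Longrightarrow> rk M (F \<union> U1 \<union> A2) = rk N1 F + card U1 + card A2"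
    and r2: "\<And>F. F \<in> proper_cyclic_flats N2 \<Longrightarrow> rk M (F \<union> U2 \<union> A1) = rk N2 F + card U2 + card A1"
    using assms by (auto simp: is_Mk_def)
  have mM: "matroid_rank M = k" by (simp add: matroid_rank_def gM rM)
  \<comment> \<open>Complementation sends the flats over \<open>N1\<close> to flats over
    \<open>dual N1\<close> that contain \<open>U2\<close> instead of \<open>U1\<close>.\<close>
  have c1: "E - (F \<union> U1 \<union> A2) = (R1 - F) \<union> U2 \<union> (R2 - A2)" "F \<union> U1 \<union> A2 \<subseteq> E"
    if "F \<subseteq> R1" for F
    using that disjoint subset by blast+
  have c2: "E - (F \<union> U2 \<union> A1) = (R2 - F) \<union> U1 \<union> (R1 - A1)" "F \<union> U2 \<union> A1 \<subseteq> E"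
    if "F \<subseteq> R2" for F
    using that disjoint subset by blast+
  have "{Z. cyclic_flat (dual M) Z} = (\<lambda>Z. E - Z) ` {Z. cyclic_flat M Z}"
  proof (intro equalityI subsetI)
    fix Z assume "Z \<in> {Z. cyclic_flat (dual M) Z}"
    then show "Z \<in> (\<lambda>Z. E - Z) ` {Z. cyclic_flat M Z}"
      by (intro image_eqI [of _ _ "E - Z"]) (simp_all add: cyclic_flat_dual_iff gM double_diff)
  next
    fix Z assume "Z \<in> (\<lambda>Z. E - Z) ` {Z. cyclic_flat M Z}"
    then show "Z \<in> {Z. cyclic_flat (dual M) Z}"
      using cyclic_flat_dual [of M] by (auto simp: gM)
  qed
  also have "\<dots> = {E, {}} \<union> (\<lambda>F. E - (F \<union> U1 \<union> A2)) ` proper_cyclic_flats N1 \<union>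
      (\<lambda>F. E - (F \<union> U2 \<union> A1)) ` proper_cyclic_flats N2"
    unfolding flats by (simp only: image_Un image_insert image_empty Setcompr_eq_image image_image
      Diff_empty Diff_cancel)
  also have "(\<lambda>F. E - (F \<union> U1 \<union> A2)) ` proper_cyclic_flats N1 =
      (\<lambda>F. (R1 - F) \<union> U2 \<union> (R2 - A2)) ` proper_cyclic_flats N1"
    by (rule image_cong [OF refl]) (rule c1 [OF proper_cyclic_flat_subset])
  also have "\<dots> = {F \<union> U2 \<union> (R2 - A2) | F. F \<in> proper_cyclic_flats (dual N1)}"
    unfolding proper_cyclic_flats_dual by (simp only: Setcompr_eq_image image_image)
  also have "(\<lambda>F. E - (F \<union> U2 \<union> A1)) ` proper_cyclic_flats N2 =
      (\<lambda>F. (R2 - F) \<union> U1 \<union> (R1 - A1)) ` proper_cyclic_flats N2"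
    by (rule image_cong [OF refl]) (rule c2 [OF proper_cyclic_flat_subset])
  also have "\<dots> = {F \<union> U1 \<union> (R1 - A1) | F. F \<in> proper_cyclic_flats (dual N2)}"
    unfolding proper_cyclic_flats_dual by (simp only: Setcompr_eq_image image_image)
  finally have dual_flats: "{Z. cyclic_flat (dual M) Z} = {{}, ground (dual M)} \<union>
      {F \<union> U2 \<union> (R2 - A2) | F. F \<in> proper_cyclic_flats (dual N1)} \<union>
      {F \<union> U1 \<union> (R1 - A1) | F. F \<in> proper_cyclic_flats (dual N2)}"
    by (simp add: gM insert_commute)
  \<comment> \<open>Both families need the same computation: compare \<open>rk_dual\<close> for
    \<open>M\<close> and for \<open>N\<close>; the extra elements \<open>U\<close> and
    \<open>B\<close> enter only by their number.\<close>
  have rank: "rk (dual M) ((ground N - F) \<union> U \<union> B) = rk (dual N) (ground N - F) + card U + card B"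
    if F: "F \<subseteq> ground N" and Z: "E - Z = (ground N - F) \<union> U \<union> B" "Z \<subseteq> E"
      and r: "rk M Z + matroid_rank N = rk N F + k"
      and disj: "(ground N - F) \<inter> U = {}" "(ground N - F) \<inter> B = {}" "U \<inter> B = {}"
      and fin: "finite U" "finite B"
    for N :: "'a matroid" and F U B Z
  proof -
    have "rk (dual M) (E - Z) + k = card (E - Z) + rk M Z"
      using rk_dual [of "E - Z" M] Z(2) by (simp add: gM mM double_diff)
    moreover have "card (E - Z) = card (ground N - F) + card U + card B"
      unfolding Z(1) using fin disj by (subst card_Un_disjoint; auto simp: card_Un_disjoint)+
    moreover have "rk (dual N) (ground N - F) + matroid_rank N = card (ground N - F) + rk N F"
      using rk_dual [of "ground N - F" N] F by (simp add: double_diff)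
    ultimately show ?thesis using r unfolding Z(1) by linarith
  qed
  have "rk (dual M) (F \<union> U2 \<union> (R2 - A2)) = rk (dual N1) F + card U2 + card (R2 - A2)"
    if F: "F \<in> proper_cyclic_flats (dual N1)" for F
  proof -
    obtain F' where F': "F = R1 - F'" "F' \<in> proper_cyclic_flats N1"
      using F unfolding proper_cyclic_flats_dual by blast
    note sub = proper_cyclic_flat_subset [OF F'(2)]
    have "rk M (F' \<union> U1 \<union> A2) + r1 = rk N1 F' + k" using r1 [OF F'(2)] card_U(1) by linarith
    then show ?thesis unfolding F'(1)
      by (intro rank [OF sub c1 [OF sub]]) (use finite_U disjoint in auto)
  qed
  moreover have "rk (dual M) (F \<union> U1 \<union> (R1 - A1)) = rk (dual N2) F + card U1 + card (R1 - A1)"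
    if F: "F \<in> proper_cyclic_flats (dual N2)" for F
  proof -
    obtain F' where F': "F = R2 - F'" "F' \<in> proper_cyclic_flats N2"
      using F unfolding proper_cyclic_flats_dual by blast
    note sub = proper_cyclic_flat_subset [OF F'(2)]
    have "rk M (F' \<union> U2 \<union> A1) + r2 = rk N2 F' + k" using r2 [OF F'(2)] card_U(2) by linarith
    then show ?thesis unfolding F'(1)
      by (intro rank [OF sub c2 [OF sub]]) (use finite_U disjoint in auto)
  qed
  moreover have "rk (dual M) (ground (dual M)) = card E - k"
    using matroid_rank_dual [of M] mM gM by (simp add: matroid_rank_def)
  moreover have "ground (dual M) = ground (dual N1) \<union> ground (dual N2) \<union> U2 \<union> U1"
    using gM by auto
  ultimately show ?thesis using dual_flats unfolding is_Mk_def by simp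
qed

end

section \<open>Assembly of the four equivalences\<close>

theorem theorem4p5:
  fixes M1 M2 M :: "'a matroid" and S1' S2' T1 T2 :: "'a set" and k :: int
  assumes "matroid_rank M1 > 0" and "matroid_rank M2 > 0"
    and "ground M1 \<inter> ground M2 = {}"
    and "S1' \<subseteq> ground M1" and "S2' \<subseteq> ground M2"
    and "k \<ge> int (matroid_rank M1) + int (nullity M1 S1') + int (matroid_rank M2) + int (nullity M2 S2')"
    and "finite T1" and "finite T2"
    and "int (card T1) = k - int (matroid_rank M1) - int (card S2')"
    and "int (card T2) = k - int (matroid_rank M2) - int (card S1')"
    and "T1 \<inter> T2 = {}"
    and "T1 \<inter> (ground M1 \<union> ground M2) = {}"
    and "T2 \<inter> (ground M1 \<union> ground M2) = {}"
    and "is_Mk k M1 S1' T1 M2 S2' T2 M"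
  shows "(transversal M1 \<and> transversal M2 \<longleftrightarrow> transversal M) \<and>
         (cotransversal M1 \<and> cotransversal M2 \<longleftrightarrow> cotransversal M) \<and>
         (bitransversal M1 \<and> bitransversal M2 \<longleftrightarrow> bitransversal M) \<and>
         (gammoid M1 \<and> gammoid M2 \<longleftrightarrow> gammoid M)"
proof -
  \<comment> \<open>The lower bound makes \<open>k\<close> nonnegative, so nothing is lost in
    passing to \<open>nat\<close>.\<close>
  define m where "m = nat k"
  have km: "k = int m" using assms(6) by (simp add: m_def)
  interpret mk_parameters M1 S1' T1 M2 S2' T2 m
    by unfold_locales (use assms km in auto)
  \<comment> \<open>The dual of \<open>M\<close> is an instance of the construction, so
    cotransversality becomes transversality for these parameters.\<close>
  interpret d: mk_parameters "dual M1" "R1 - S1'" T2 "dual M2" "R2 - S2'" T1 "card E - m"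
    by (rule dual_parameters)
  have Mk: "is_Mk (int m) M1 S1' T1 M2 S2' T2 M" using assms(14) km by simp
  have g: "ground M = E" "ground (dual M) = d.E" using Mk by (auto simp: is_Mk_def)
  have "transversal M1 \<and> transversal M2 \<longleftrightarrow> transversal M"
    by (rule transversal_iff [OF g(1) indep_iff_mk_indep [OF Mk]])
  moreover have "cotransversal M1 \<and> cotransversal M2 \<longleftrightarrow> cotransversal M"
    unfolding cotransversal_def
    by (rule d.transversal_iff [OF g(2) d.indep_iff_mk_indep [OF is_Mk_dual [OF Mk]]])
  moreover have "gammoid M1 \<and> gammoid M2 \<longleftrightarrow> gammoid M"
    by (rule gammoid_iff [OF g(1) indep_iff_mk_indep [OF Mk]])
  ultimately show ?thesis unfolding bitransversal_def by blast
qed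

end
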